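(* Let $\rho\in(0,1)$ and let $p(\cdot)$ be a jump law on $\mathbb Z$ with non-zero drift such that $p(z)=0$ for $|z|\ne1$ (nearest neighbor). Let $D(t)$ be the diffusivity, at density $\rho$, of the exclusion process with jump law $p(\cdot)$. Then $tD(t)$ is non-decreasing in $t$.
   Context: A jump law is $p:\mathbb Z\to[0,\infty)$ with $\sum_z p(z)=1$; its drift is $b:=\sum_z z p(z)$. The exclusion process with jump law $p$ is the Markov process on $\{0,1\}^{\mathbb Z}$ with generator $$Lf(\eta)=\sum_{x,z\in\mathbb Z}p(z)\,\eta_x(1-\eta_{x+z})\,(f(\eta^{x,x+z})-f(\eta)),$$ where $\eta^{x,y}$ is $\eta$ with the occupation variables at $x$ and $y$ interchanged. The Bernoulli product measure $\pi_\rho$ with $\pi_\rho(\eta_x=1)=\rho$ is invariant; consider the stationary process $\eta(t)$ started from $\pi_\rho$, with expectation $E$. Let $\chi=\rho(1-\rho)$ and $S(x,t)=E[(\eta_x(t)-\rho)(\eta_0(0)-\rho)]$. The diffusivity is $$D(t)=(\chi t)^{-1}\sum_{x\in\mathbb Z}(x-(1-2\rho)bt)^2 S(x,t).$$ *)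

theory Defs
  imports "HOL-Probability.Probability"
begin

text \<open>
  A jump law is a probability mass function on the integers.  A configuration
  \<open>\<eta>\<close> maps a site to \<^const>\<open>True\<close> iff the site is occupied; the space of configurations
  carries the product topology and its Borel \<open>\<sigma>\<close>-algebra.
\<close>

type_synonym config = "int \<Rightarrow> bool"

definition drift :: "int pmf \<Rightarrow> real" where
  "drift p = (\<Sum>\<^sub>\<infinity>z. real_of_int z * pmf p z)"

definition nearest_neighbor :: "int pmf \<Rightarrow> bool" where
  "nearest_neighbor p \<longleftrightarrow> (\<forall>z. \<bar>z\<bar> \<noteq> 1 \<longrightarrow> pmf p z = 0)"

definition exchange :: "int \<Rightarrow> int \<Rightarrow> config \<Rightarrow> config" where
  "exchange x y \<eta> = \<eta>(x := \<eta> y, y := \<eta> x)"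

definition exclusion_operator :: "int pmf \<Rightarrow> (config \<Rightarrow> real) \<Rightarrow> config \<Rightarrow> real" where
  "exclusion_operator p f \<eta> =
     (\<Sum>\<^sub>\<infinity>(x, z)\<in>UNIV. pmf p z * of_bool (\<eta> x) * (1 - of_bool (\<eta> (x + z)))
        * (f (exchange x (x + z) \<eta>) - f \<eta>))"

definition cylinder :: "(config \<Rightarrow> real) \<Rightarrow> bool" where
  "cylinder f \<longleftrightarrow>
     (\<exists>A. finite A \<and> (\<forall>\<eta> \<zeta>. (\<forall>x\<in>A. \<eta> x = \<zeta> x) \<longrightarrow> f \<eta> = f \<zeta>))"

text \<open>
  Strongly continuous Markov semigroups on the Banach space of (automatically bounded)
  continuous functions of the configuration; only times \<open>t \<ge> 0\<close> are relevant.
\<close>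

type_synonym observable = "config \<Rightarrow>\<^sub>C real"

definition markov_semigroup :: "(real \<Rightarrow> observable \<Rightarrow> observable) \<Rightarrow> bool" where
  "markov_semigroup P \<longleftrightarrow>
     (\<forall>t\<ge>0. linear (P t)) \<and>
     (\<forall>f. P 0 f = f) \<and>
     (\<forall>s\<ge>0. \<forall>t\<ge>0. \<forall>f. P (s + t) f = P s (P t f)) \<and>
     (\<forall>t\<ge>0. P t (const_bcontfun 1) = const_bcontfun 1) \<and>
     (\<forall>t\<ge>0. \<forall>f. (\<forall>\<eta>. 0 \<le> apply_bcontfun f \<eta>) \<longrightarrow> (\<forall>\<eta>. 0 \<le> apply_bcontfun (P t f) \<eta>)) \<and>
     (\<forall>f. ((\<lambda>t. P t f) \<longlongrightarrow> f) (at_right 0))"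

definition generator :: "(real \<Rightarrow> observable \<Rightarrow> observable) \<Rightarrow> (observable \<times> observable) set" where
  "generator P = {(f, g). ((\<lambda>t. (P t f - f) /\<^sub>R t) \<longlongrightarrow> g) (at_right 0)}"

text \<open>
  The generator of the exclusion process is the closure (of the graph) of the explicit
  operator on cylinder functions, i.e. cylinder functions form a core.  This determines
  the semigroup uniquely.
\<close>

definition exclusion_pregenerator :: "int pmf \<Rightarrow> (observable \<times> observable) set" where
  "exclusion_pregenerator p =
     {(f, g). cylinder (apply_bcontfun f) \<and>
        apply_bcontfun g = exclusion_operator p (apply_bcontfun f)}"

definition exclusion_semigroup :: "int pmf \<Rightarrow> (real \<Rightarrow> observable \<Rightarrow> observable) \<Rightarrow> bool" where
  "exclusion_semigroup p P \<longleftrightarrow>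
     markov_semigroup P \<and> generator P = closure (exclusion_pregenerator p)"

definition history :: "'w measure \<Rightarrow> (real \<Rightarrow> 'w \<Rightarrow> config) \<Rightarrow> real \<Rightarrow> 'w measure" where
  "history M \<eta> s =
     sigma (space M) {\<eta> u -` B \<inter> space M | u B. 0 \<le> u \<and> u \<le> s \<and> B \<in> sets borel}"

definition exclusion_process ::
  "int pmf \<Rightarrow> 'w measure \<Rightarrow> (real \<Rightarrow> 'w \<Rightarrow> config) \<Rightarrow> bool" where
  "exclusion_process p M \<eta> \<longleftrightarrow>
     prob_space M \<and>
     (\<forall>t\<ge>0. \<eta> t \<in> M \<rightarrow>\<^sub>M borel) \<and>
     (\<exists>P. exclusion_semigroup p P \<and>
        (\<forall>s\<ge>0. \<forall>t\<ge>0. \<forall>f. AE \<omega> in M.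
           real_cond_exp M (history M \<eta> s) (\<lambda>\<omega>. apply_bcontfun f (\<eta> (s + t) \<omega>)) \<omega>
           = apply_bcontfun (P t f) (\<eta> s \<omega>)))"

definition bernoulli_product :: "real \<Rightarrow> config measure" where
  "bernoulli_product \<rho> = (\<Pi>\<^sub>M x\<in>UNIV. measure_pmf (bernoulli_pmf \<rho>))"

instance bool :: second_countable_topology
proof
  have "open S \<longleftrightarrow> generate_topology (UNIV :: bool set set) S" for S
    by (simp add: Topological_Spaces.open_discrete generate_topology.Basis)
  then show "\<exists>B::bool set set. countable B \<and> open = generate_topology B"
    by (intro exI[of _ UNIV]) (auto simp: fun_eq_iff intro: countable_finite)
qed

lemma sets_bernoulli_product [measurable_cong]: "sets (bernoulli_product \<rho>) = sets borel"
proof -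
  have "sets (bernoulli_product \<rho>) = sets (\<Pi>\<^sub>M x\<in>(UNIV::int set). (borel :: bool measure))"
    unfolding bernoulli_product_def
    by (rule sets_PiM_cong) (simp_all add: sets_borel_eq_count_space)
  then show ?thesis
    by (simp add: sets_PiM_equal_borel)
qed

text \<open>
  Since the Bernoulli product measures are invariant, starting from one of them makes
  the process stationary.
\<close>

definition stationary_exclusion_process ::
  "int pmf \<Rightarrow> real \<Rightarrow> 'w measure \<Rightarrow> (real \<Rightarrow> 'w \<Rightarrow> config) \<Rightarrow> bool" where
  "stationary_exclusion_process p \<rho> M \<eta> \<longleftrightarrow>
     exclusion_process p M \<eta> \<and> distr M borel (\<eta> 0) = bernoulli_product \<rho>"

definition two_point ::
  "real \<Rightarrow> 'w measure \<Rightarrow> (real \<Rightarrow> 'w \<Rightarrow> config) \<Rightarrow> int \<Rightarrow> real \<Rightarrow> real" where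
  "two_point \<rho> M \<eta> x t =
     (\<integral>\<omega>. (of_bool (\<eta> t \<omega> x) - \<rho>) * (of_bool (\<eta> 0 \<omega> 0) - \<rho>) \<partial>M)"

definition diffusivity ::
  "int pmf \<Rightarrow> real \<Rightarrow> 'w measure \<Rightarrow> (real \<Rightarrow> 'w \<Rightarrow> config) \<Rightarrow> real \<Rightarrow> real" where
  "diffusivity p \<rho> M \<eta> t =
     inverse (\<rho> * (1 - \<rho>) * t) *
     (\<Sum>\<^sub>\<infinity>x. (real_of_int x - (1 - 2 * \<rho>) * drift p * t)\<^sup>2 * two_point \<rho> M \<eta> x t)"

end

theory Submission
  imports Defs "HOL-Real_Asymp.Real_Asymp"
begin

text \<open>
  With \<open>b\<close> the drift and \<open>v = (1 - 2\<rho>) b\<close>, reversibility up to exchanging left and right jumps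
  and translation invariance turn the time derivative of the second moment
  \<open>\<Sum>\<^sub>x (x - v t)\<^sup>2 S(x, t)\<close> into
  \<open>\<chi> - 2 b \<Sum>\<^sub>x x \<langle>(\<eta>\<^sub>0 - \<rho>) (\<eta>\<^sub>1 - \<rho>), P\<^sub>t \<eta>\<^sub>x\<rangle>\<close>.
  The last sum is \<open>- \<chi>\<^sup>2\<close> times the mean of \<open>f(10) + f(01) - f(00) - f(11)\<close>, where
  \<open>f = P\<^sub>t (\<Sum>\<^sub>x x \<eta>\<^sub>x)\<close> and the digits prescribe \<open>\<eta>\<^sub>0, \<eta>\<^sub>1\<close>.  Couple the four
  processes: their two discrepancies move as ordered second class particles \<open>Y < Z\<close> until the
  configurations 10 and 01 coalesce, to the right with probability \<open>p\<close> and to the left with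
  probability \<open>q\<close>, after which the mean is \<open>(p - q) (Z - Y)\<close>.  Hence \<open>b\<close> times the mean is
  non-negative.  The coupling is replaced by a minimum principle for an Euler scheme in a finite box,
  which approximates the semigroup because the influence of a site decays exponentially with the
  distance.
\<close>

section \<open>Euler scheme in a finite box\<close>

text \<open>The obstacle is that the sum of \<open>x * occ x\<close> over all sites is unbounded, so
  \<open>P t\<close> acts only on each \<open>occ x\<close> and every statement about moments
  concerns a finite sum with an explicit error. Signs are proved for the scheme in a closed box and
  passed on in two limits: first the number of steps grows with the box fixed, then the box grows.
  Both limits are controlled by one estimate, the exponentially decaying influence of a site,
  uniform over the steps of the scheme. The form f(10) + f(01) - f(00) - f(11) is not preserved by
  the dynamics, because the bond between adjacent discrepancies changes its weights. The new weights
  \<open>2 * q\<close> and \<open>2 * p\<close> are invariant under that bond. Hence the minimum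
  principle runs twice, first for the coalesced form and then, with its help, for the original
  one.\<close>

definition depends_on :: "(config \<Rightarrow> real) \<Rightarrow> int set \<Rightarrow> bool" where
  "depends_on f A \<longleftrightarrow> (\<forall>\<eta> \<zeta>. (\<forall>x\<in>A. \<eta> x = \<zeta> x) \<longrightarrow> f \<eta> = f \<zeta>)"

definition occ :: "int \<Rightarrow> config \<Rightarrow> real" where
  "occ x \<eta> = of_bool (\<eta> x)"

lemma depends_onD: "depends_on f A \<Longrightarrow> (\<And>x. x \<in> A \<Longrightarrow> \<eta> x = \<zeta> x) \<Longrightarrow> f \<eta> = f \<zeta>"
  unfolding depends_on_def by blast

lemma depends_on_mono: "depends_on f A \<Longrightarrow> A \<subseteq> B \<Longrightarrow> depends_on f B"
  unfolding depends_on_def by blast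

lemma depends_on_occ: "x \<in> A \<Longrightarrow> depends_on (occ x) A"
  by (simp add: depends_on_def occ_def)

lemma flip_bound:
  fixes f :: "config \<Rightarrow> real"
  assumes "\<And>\<eta>. \<bar>f (\<eta>(y := True)) - f (\<eta>(y := False))\<bar> \<le> d"
  shows "\<bar>f (\<eta>(y := u)) - f \<eta>\<bar> \<le> d"
proof -
  have "0 \<le> d" using assms[of \<eta>] by linarith
  then show ?thesis
    using assms[of \<eta>] fun_upd_idem[of \<eta> y True] fun_upd_idem[of \<eta> y False]
    by (cases u; cases "\<eta> y") (simp_all add: abs_minus_commute)
qed

lemma exchange_bound:
  fixes f :: "config \<Rightarrow> real"
  assumes "\<And>y \<eta>. \<bar>f (\<eta>(y := True)) - f (\<eta>(y := False))\<bar> \<le> m y"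
  shows "\<bar>f (exchange x y \<eta>) - f \<eta>\<bar> \<le> m x + m y"
proof -
  have "\<bar>f (\<eta>(x := \<eta> y)) - f \<eta>\<bar> \<le> m x"
    using assms by (rule flip_bound)
  moreover have "\<bar>f ((\<eta>(x := \<eta> y))(y := \<eta> x)) - f (\<eta>(x := \<eta> y))\<bar> \<le> m y"
    using assms by (rule flip_bound)
  ultimately show ?thesis unfolding exchange_def by linarith
qed

text \<open>With \<open>c = d = 1\<close> this is minus the mixed second difference of
  \<open>f\<close> in the sites \<open>y\<close> and \<open>z\<close>. Whenever
  \<open>c + d = 2\<close> it annihilates constants and sees \<open>moment\<close> only through
  \<open>g y\<close> and \<open>g z\<close>.\<close>

definition quad :: "real \<Rightarrow> real \<Rightarrow> (config \<Rightarrow> real) \<Rightarrow> config \<Rightarrow> int \<Rightarrow> int \<Rightarrow> real" where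
  "quad c d f \<eta> y z = c * f (\<eta>(y := True, z := False)) + d * f (\<eta>(y := False, z := True))
     - f (\<eta>(y := False, z := False)) - f (\<eta>(y := True, z := True))"

definition moment :: "int \<Rightarrow> int \<Rightarrow> (int \<Rightarrow> real) \<Rightarrow> config \<Rightarrow> real" where
  "moment a b g \<eta> = (\<Sum>x\<in>{a..b}. g x * occ x \<eta>)"

lemma moment_upd:
  assumes "a \<le> y" "y \<le> b"
  shows "moment a b g (\<eta>(y := v)) = moment a b g (\<eta>(y := False)) + g y * of_bool v"
proof -
  have "moment a b g (\<eta>(y := v)) - moment a b g (\<eta>(y := False))
      = (\<Sum>x\<in>{a..b}. if x = y then g y * of_bool v else 0)"
    unfolding moment_def sum_subtractf[symmetric] by (intro sum.cong) (auto simp: occ_def)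
  then show ?thesis using assms by simp
qed

lemma moment_upd2:
  assumes "a \<le> y" "y < z" "z \<le> b"
  shows "moment a b g (\<eta>(y := i, z := j))
      = moment a b g (\<eta>(y := False, z := False)) + g y * of_bool i + g z * of_bool j"
proof -
  have "moment a b g (\<eta>(y := i, z := j)) = moment a b g (\<eta>(y := i, z := False)) + g z * of_bool j"
    using assms by (intro moment_upd) auto
  also have "\<eta>(y := i, z := False) = \<eta>(z := False, y := i)"
    using assms by (intro fun_upd_twist) auto
  also have "moment a b g (\<eta>(z := False, y := i)) = moment a b g (\<eta>(z := False, y := False)) + g y * of_bool i"
    using assms by (intro moment_upd) auto
  also have "\<eta>(z := False, y := False) = \<eta>(y := False, z := False)"
    using assms by (intro fun_upd_twist) auto
  finally show ?thesis .
qed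

lemma quad_moment:
  assumes "a \<le> y" "y < z" "z \<le> b"
  shows "quad c d (moment a b g) \<eta> y z
    = (c + d - 2) * moment a b g (\<eta>(y := False, z := False)) + (c - 1) * g y + (d - 1) * g z"
  unfolding quad_def
  using moment_upd2[OF assms, of g \<eta> True False] moment_upd2[OF assms, of g \<eta> False True]
    moment_upd2[OF assms, of g \<eta> True True]
  by (simp add: algebra_simps)

locale nn_rates =
  fixes p q :: real
  assumes p_nonneg: "0 \<le> p" and q_nonneg: "0 \<le> q" and pq: "p + q = 1"
begin

text \<open>Indexed by bonds rather than jumps: a particle crosses to the right at rate
  \<open>p\<close> and to the left at rate \<open>q\<close>, and either jump is the exchange of the
  two ends.\<close>

definition rate :: "int \<Rightarrow> config \<Rightarrow> real" where
  "rate x \<eta> = (if \<eta> x = \<eta> (x + 1) then 0 else if \<eta> x then p else q)"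

definition bond :: "int \<Rightarrow> (config \<Rightarrow> real) \<Rightarrow> config \<Rightarrow> real" where
  "bond x f \<eta> = rate x \<eta> * (f (exchange x (x + 1) \<eta>) - f \<eta>)"

text \<open>Closed box: the bonds leading out of \<open>{a..b}\<close> are cut, so iterates stay
  supported in the box and its number of particles is conserved.\<close>

definition box_gen :: "int \<Rightarrow> int \<Rightarrow> (config \<Rightarrow> real) \<Rightarrow> config \<Rightarrow> real" where
  "box_gen a b f \<eta> = (\<Sum>x\<in>{a..<b}. bond x f \<eta>)"

definition euler :: "int \<Rightarrow> int \<Rightarrow> real \<Rightarrow> (config \<Rightarrow> real) \<Rightarrow> config \<Rightarrow> real" where
  "euler a b h f \<eta> = f \<eta> + h * box_gen a b f \<eta>"

lemma rate_bounds: "0 \<le> rate x \<eta>" "rate x \<eta> \<le> 1"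
  using p_nonneg q_nonneg pq by (auto simp: rate_def)

lemma depends_on_bond:
  assumes "depends_on f A" "x \<in> A" "x + 1 \<in> A"
  shows "depends_on (bond x f) A"
  unfolding depends_on_def
proof (intro allI impI)
  fix \<eta> \<zeta> :: config assume *: "\<forall>x\<in>A. \<eta> x = \<zeta> x"
  have "f (exchange x (x + 1) \<eta>) = f (exchange x (x + 1) \<zeta>)" "f \<eta> = f \<zeta>"
    using * assms(2,3) by (auto intro!: depends_onD[OF assms(1)] simp: exchange_def)
  moreover have "rate x \<eta> = rate x \<zeta>" using * assms(2,3) by (simp add: rate_def)
  ultimately show "bond x f \<eta> = bond x f \<zeta>" by (simp add: bond_def)
qed

lemma depends_on_box_gen:
  "depends_on f {a..b} \<Longrightarrow> depends_on (box_gen a b f) {a..b}"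
  unfolding depends_on_def box_gen_def
  apply (intro allI impI sum.cong refl)
  subgoal for \<eta> \<zeta> x
    using depends_on_bond[of f "{a..b}" x] unfolding depends_on_def by auto
  done

lemma depends_on_euler:
  "depends_on f {a..b} \<Longrightarrow> depends_on (euler a b h f) {a..b}"
  using depends_on_box_gen[of f a b] unfolding depends_on_def euler_def by metis

lemma depends_on_euler_pow:
  "depends_on f {a..b} \<Longrightarrow> depends_on ((euler a b h ^^ n) f) {a..b}"
  by (induction n) (auto intro: depends_on_euler)

lemma euler_add: "euler a b h (\<lambda>\<eta>. f \<eta> + g \<eta>) = (\<lambda>\<eta>. euler a b h f \<eta> + euler a b h g \<eta>)"
  by (rule ext) (simp add: euler_def box_gen_def bond_def algebra_simps sum.distrib sum_subtractf)

lemma euler_scale: "euler a b h (\<lambda>\<eta>. c * f \<eta>) = (\<lambda>\<eta>. c * euler a b h f \<eta>)"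
  by (rule ext) (simp add: euler_def box_gen_def bond_def algebra_simps sum_subtractf sum_distrib_left)

lemma euler_sum:
  "euler a b h (\<lambda>\<eta>. \<Sum>i\<in>I. g i * f i \<eta>) = (\<lambda>\<eta>. \<Sum>i\<in>I. g i * euler a b h (f i) \<eta>)"
proof (induction I rule: infinite_finite_induct)
  case (insert i I)
  then show ?case
    by (simp add: euler_add[of a b h "\<lambda>\<eta>. g i * f i \<eta>"] euler_scale)
qed (simp_all add: euler_def box_gen_def bond_def fun_eq_iff)

lemma euler_pow_sum:
  "(euler a b h ^^ n) (\<lambda>\<eta>. \<Sum>i\<in>I. g i * f i \<eta>) = (\<lambda>\<eta>. \<Sum>i\<in>I. g i * (euler a b h ^^ n) (f i) \<eta>)"
  by (induction n) (simp_all add: euler_sum)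

lemma sum_rate_le:
  assumes "0 \<le> h" "h * real_of_int (b - a) \<le> 1" "a \<le> b" "B \<subseteq> {a..<b}"
  shows "h * (\<Sum>x\<in>B. rate x (\<eta> x)) \<le> 1"
proof -
  have "(\<Sum>x\<in>B. rate x (\<eta> x)) \<le> (\<Sum>x\<in>{a..<b}. rate x (\<eta> x))"
    using assms(4) by (intro sum_mono2) (auto simp: rate_bounds)
  also have "\<dots> \<le> (\<Sum>x\<in>{a..<b}. 1)"
    by (intro sum_mono) (auto simp: rate_bounds)
  also have "\<dots> = real_of_int (b - a)" using assms(3) by simp
  finally have "h * (\<Sum>x\<in>B. rate x (\<eta> x)) \<le> h * real_of_int (b - a)"
    using assms(1) by (rule mult_left_mono)
  then show ?thesis using assms(2) by linarith
qed

text \<open>The jump probabilities \<open>h * rate x \<eta>\<close> sum to \<open>s \<le> 1\<close>,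
  so one Euler step averages \<open>f\<close> over a probability distribution on
  \<open>\<eta>\<close> and its exchanges.\<close>

lemma euler_bounds:
  assumes "0 \<le> h" "h * real_of_int (b - a) \<le> 1" "a \<le> b"
    and f: "\<And>\<eta>. l \<le> f \<eta>" "\<And>\<eta>. f \<eta> \<le> u"
  shows "l \<le> euler a b h f \<eta>" "euler a b h f \<eta> \<le> u"
proof -
  define s where "s = h * (\<Sum>x\<in>{a..<b}. rate x \<eta>)"
  have s: "0 \<le> s" "s \<le> 1"
    unfolding s_def using sum_rate_le[of h b a "{a..<b}"] assms
    by (auto intro!: mult_nonneg_nonneg sum_nonneg rate_bounds)
  have "h * (\<Sum>x\<in>{a..<b}. rate x \<eta> * (l - f \<eta>)) \<le> h * box_gen a b f \<eta>"
    unfolding box_gen_def bond_def using assms(1) f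
    by (intro mult_left_mono sum_mono rate_bounds) auto
  then have "s * (l - f \<eta>) \<le> h * box_gen a b f \<eta>"
    by (simp add: s_def sum_distrib_right sum_distrib_left mult.assoc)
  moreover have "(1 - s) * (l - f \<eta>) \<le> 0"
    using s f(1)[of \<eta>] by (simp add: mult_nonneg_nonpos)
  ultimately show "l \<le> euler a b h f \<eta>"
    unfolding euler_def by (simp add: algebra_simps)
  have "h * box_gen a b f \<eta> \<le> h * (\<Sum>x\<in>{a..<b}. rate x \<eta> * (u - f \<eta>))"
    unfolding box_gen_def bond_def using assms(1) f
    by (intro mult_left_mono sum_mono rate_bounds) auto
  then have "h * box_gen a b f \<eta> \<le> s * (u - f \<eta>)"
    by (simp add: s_def sum_distrib_right sum_distrib_left mult.assoc)
  moreover have "0 \<le> (1 - s) * (u - f \<eta>)"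
    using s f(2)[of \<eta>] by simp
  ultimately show "euler a b h f \<eta> \<le> u"
    unfolding euler_def by (simp add: algebra_simps)
qed

lemma euler_pow_bounds:
  assumes "0 \<le> h" "h * real_of_int (b - a) \<le> 1" "a \<le> b"
    and "\<And>\<eta>. l \<le> f \<eta>" "\<And>\<eta>. f \<eta> \<le> u"
  shows "l \<le> (euler a b h ^^ n) f \<eta> \<and> (euler a b h ^^ n) f \<eta> \<le> u"
proof (induction n arbitrary: \<eta>)
  case (Suc n)
  then show ?case
    using euler_bounds[OF assms(1-3), of l "(euler a b h ^^ n) f" u] by simp
qed (use assms in auto)

section \<open>Spatial decay of the influence of a site\<close>

text \<open>The bonds away from \<open>y\<close> commute with flipping \<open>y\<close>; together
  with the probability of staying put they average old differences. Only the two bonds at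
  \<open>y\<close> create new influence, each at most what an exchange across it can change.\<close>

lemma euler_flip_bound:
  assumes h: "0 \<le> h" "h * real_of_int (b - a) \<le> 1" "a \<le> b"
    and m: "\<And>y \<eta>. \<bar>f (\<eta>(y := True)) - f (\<eta>(y := False))\<bar> \<le> m y"
  shows "\<bar>euler a b h f (\<eta>(y := True)) - euler a b h f (\<eta>(y := False))\<bar>
    \<le> m y + h * (2 * m y + m (y - 1) + m (y + 1))"
proof -
  let ?T = "\<eta>(y := True)" and ?F = "\<eta>(y := False)"
  define B where "B = {a..<b} - {y - 1, y}"
  define \<zeta> where "\<zeta> x = exchange x (x + 1) \<eta>" for x
  define D where "D \<eta> = f (\<eta>(y := True)) - f (\<eta>(y := False))" for \<eta>
  have m0: "0 \<le> m x" for x using m[of undefined x] by linarith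
  have far: "bond x f ?T - bond x f ?F = rate x \<eta> * (D (\<zeta> x) - D \<eta>)" if "x \<in> B" for x
  proof -
    have x: "x \<noteq> y" "x + 1 \<noteq> y" using that by (auto simp: B_def)
    then have "exchange x (x + 1) (\<eta>(y := v)) = (\<zeta> x)(y := v)" "rate x (\<eta>(y := v)) = rate x \<eta>" for v
      by (auto simp: exchange_def \<zeta>_def fun_eq_iff rate_def)
    then show ?thesis by (simp add: bond_def D_def algebra_simps)
  qed
  have near: "\<bar>bond x f ?T - bond x f ?F\<bar> \<le> m x + m (x + 1)" if "x = y \<or> x = y - 1" for x
  proof -
    have *: "\<bar>bond x f \<xi>\<bar> \<le> m x + m (x + 1)" for \<xi>
    proof -
      have "\<bar>bond x f \<xi>\<bar> \<le> 1 * (m x + m (x + 1))"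
        unfolding bond_def abs_mult
        by (intro mult_mono exchange_bound m) (auto simp: rate_bounds)
      then show ?thesis by simp
    qed
    \<comment> \<open>The other end of the bond agrees with one of the two values at
      \<open>y\<close>, so the bond is frozen in one of the two configurations.\<close>
    from that have "rate x ?T = 0 \<or> rate x ?F = 0" by (auto simp: rate_def)
    then have "bond x f ?T = 0 \<or> bond x f ?F = 0" by (auto simp: bond_def)
    then show ?thesis using *[of ?T] *[of ?F] by auto
  qed
  define s where "s = h * (\<Sum>x\<in>B. rate x \<eta>)"
  have s: "s \<le> 1" "0 \<le> s"
    unfolding s_def using h by (auto intro!: sum_rate_le mult_nonneg_nonneg sum_nonneg rate_bounds simp: B_def)
  have main: "\<bar>D \<eta> + h * (\<Sum>x\<in>B. rate x \<eta> * (D (\<zeta> x) - D \<eta>))\<bar> \<le> m y"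
  proof -
    have "D \<eta> + h * (\<Sum>x\<in>B. rate x \<eta> * (D (\<zeta> x) - D \<eta>))
        = (1 - s) * D \<eta> + h * (\<Sum>x\<in>B. rate x \<eta> * D (\<zeta> x))"
      by (simp add: s_def algebra_simps sum_subtractf sum_distrib_left)
    moreover have "\<bar>(1 - s) * D \<eta>\<bar> \<le> (1 - s) * m y"
      using s m by (simp add: abs_mult D_def mult_left_mono)
    moreover have "\<bar>h * (\<Sum>x\<in>B. rate x \<eta> * D (\<zeta> x))\<bar> \<le> h * (\<Sum>x\<in>B. rate x \<eta> * m y)"
    proof -
      have "\<bar>\<Sum>x\<in>B. rate x \<eta> * D (\<zeta> x)\<bar> \<le> (\<Sum>x\<in>B. rate x \<eta> * m y)"
        by (rule order_trans[OF sum_abs])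
          (auto intro!: sum_mono mult_left_mono simp: abs_mult rate_bounds D_def m)
      then show ?thesis using h by (simp add: abs_mult mult_left_mono)
    qed
    moreover have "h * (\<Sum>x\<in>B. rate x \<eta> * m y) = s * m y"
      by (simp add: s_def sum_distrib_right mult.assoc)
    ultimately show ?thesis by (simp add: algebra_simps)
  qed
  define C where "C = {a..<b} \<inter> {y - 1, y}"
  have "(\<Sum>x\<in>{a..<b}. bond x f ?T - bond x f ?F)
      = (\<Sum>x\<in>B. bond x f ?T - bond x f ?F) + (\<Sum>x\<in>C. bond x f ?T - bond x f ?F)"
    unfolding B_def C_def by (subst sum.union_disjoint[symmetric]) (auto intro!: sum.cong)
  moreover have "\<bar>\<Sum>x\<in>C. bond x f ?T - bond x f ?F\<bar> \<le> 2 * m y + m (y - 1) + m (y + 1)"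
  proof -
    have "\<bar>\<Sum>x\<in>C. bond x f ?T - bond x f ?F\<bar> \<le> (\<Sum>x\<in>C. m x + m (x + 1))"
      by (rule order_trans[OF sum_abs]) (auto intro!: sum_mono near simp: C_def)
    also have "\<dots> \<le> (\<Sum>x\<in>{y - 1, y}. m x + m (x + 1))"
      by (intro sum_mono2) (auto simp: C_def m0)
    finally show ?thesis by simp
  qed
  ultimately have "\<bar>(\<Sum>x\<in>{a..<b}. bond x f ?T - bond x f ?F)
      - (\<Sum>x\<in>B. rate x \<eta> * (D (\<zeta> x) - D \<eta>))\<bar> \<le> 2 * m y + m (y - 1) + m (y + 1)"
    by (simp add: far)
  then have "\<bar>h * (\<Sum>x\<in>{a..<b}. bond x f ?T - bond x f ?F)
      - h * (\<Sum>x\<in>B. rate x \<eta> * (D (\<zeta> x) - D \<eta>))\<bar> \<le> h * (2 * m y + m (y - 1) + m (y + 1))"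
    using h(1) by (simp add: abs_mult mult_left_mono flip: right_diff_distrib)
  moreover have "euler a b h f ?T - euler a b h f ?F = D \<eta> + h * (\<Sum>x\<in>{a..<b}. bond x f ?T - bond x f ?F)"
    by (simp add: euler_def box_gen_def D_def sum_subtractf algebra_simps)
  ultimately show ?thesis using main by linarith
qed

lemma half_power_neighbour:
  "(1/2::real) ^ nat \<bar>y - 1 - x\<bar> \<le> 2 * (1/2) ^ nat \<bar>y - x\<bar>"
  "(1/2::real) ^ nat \<bar>y + 1 - x\<bar> \<le> 2 * (1/2) ^ nat \<bar>y - x\<bar>"
proof -
  have *: "(1/2::real) ^ k \<le> 2 * (1/2) ^ l" if "l \<le> Suc k" for k l
    using power_decreasing[OF that, of "1/2::real"] by simp
  show "(1/2::real) ^ nat \<bar>y - 1 - x\<bar> \<le> 2 * (1/2) ^ nat \<bar>y - x\<bar>" by (rule *) linarith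
  show "(1/2::real) ^ nat \<bar>y + 1 - x\<bar> \<le> 2 * (1/2) ^ nat \<bar>y - x\<bar>" by (rule *) linarith
qed

text \<open>The profile \<open>(1/2) ^ nat \<bar>y - x\<bar>\<close> at most doubles from a site to
  its neighbour, so the increment \<open>2 * m y + m (y - 1) + m (y + 1)\<close> is at most
  \<open>6 * m y\<close>. This is the origin of the 6 in \<open>exp (6 * t)\<close>.\<close>

lemma euler_pow_occ_flip:
  assumes h: "0 \<le> h" "h * real_of_int (b - a) \<le> 1" "a \<le> b"
  shows "\<bar>(euler a b h ^^ n) (occ x) (\<eta>(y := True)) - (euler a b h ^^ n) (occ x) (\<eta>(y := False))\<bar>
    \<le> (1 + 6 * h) ^ n * (1/2) ^ nat \<bar>y - x\<bar>"
proof (induction n arbitrary: \<eta> y)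
  case 0
  then show ?case by (auto simp: occ_def)
next
  case (Suc n)
  let ?m = "\<lambda>y. (1 + 6 * h) ^ n * (1/2) ^ nat \<bar>y - x\<bar>"
  have "\<bar>(euler a b h ^^ Suc n) (occ x) (\<eta>(y := True)) - (euler a b h ^^ Suc n) (occ x) (\<eta>(y := False))\<bar>
    \<le> ?m y + h * (2 * ?m y + ?m (y - 1) + ?m (y + 1))"
    using euler_flip_bound[OF h, of "(euler a b h ^^ n) (occ x)" ?m] Suc.IH by simp
  also have "\<dots> \<le> ?m y + h * (2 * ?m y + 2 * ?m y + 2 * ?m y)"
  proof -
    have "0 \<le> (1 + 6 * h) ^ n" using h(1) by simp
    then have "?m (y - 1) \<le> 2 * ?m y" "?m (y + 1) \<le> 2 * ?m y"
      using mult_left_mono[OF half_power_neighbour(1)[of y x], of "(1 + 6 * h) ^ n"]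
        mult_left_mono[OF half_power_neighbour(2)[of y x], of "(1 + 6 * h) ^ n"]
      by (simp_all only: mult.left_commute)
    then show ?thesis using h(1) by (intro add_left_mono mult_left_mono) linarith+
  qed
  also have "\<dots> = (1 + 6 * h) ^ Suc n * (1/2) ^ nat \<bar>y - x\<bar>"
    by (simp add: algebra_simps)
  finally show ?case .
qed

lemma euler_pow_occ_flip_exp:
  assumes "0 \<le> t" "t / real n * real_of_int (b - a) \<le> 1" "a \<le> b" "k \<le> n" "0 < n"
  shows "\<bar>(euler a b (t / n) ^^ k) (occ x) (\<eta>(y := True)) - (euler a b (t / n) ^^ k) (occ x) (\<eta>(y := False))\<bar>
    \<le> exp (6 * t) * (1/2) ^ nat \<bar>y - x\<bar>"
proof -
  have "(1 + 6 * (t / n)) ^ k \<le> (1 + 6 * (t / n)) ^ n"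
    using assms by (intro power_increasing) auto
  also have "\<dots> \<le> exp (6 * (t / n)) ^ n"
    using assms(1) by (intro power_mono) auto
  also have "\<dots> = exp (6 * t)"
    using assms(5) by (simp flip: exp_of_nat_mult)
  finally have "(1 + 6 * (t / n)) ^ k * (1/2) ^ nat \<bar>y - x\<bar> \<le> exp (6 * t) * (1/2) ^ nat \<bar>y - x\<bar>"
    by (rule mult_right_mono) simp
  moreover have "0 \<le> t / n" using assms(1) by simp
  ultimately show ?thesis
    using euler_pow_occ_flip[of "t / n" b a k x \<eta> y] assms(2,3) by linarith
qed

section \<open>Two discrepancies\<close>

lemma quad_euler:
  "quad c d (euler a b h f) \<eta> y z = quad c d f \<eta> y z + h * (\<Sum>x\<in>{a..<b}. quad c d (bond x f) \<eta> y z)"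
  by (simp add: quad_def euler_def box_gen_def algebra_simps sum.distrib sum_subtractf sum_distrib_left)

text \<open>
  Unless the bond joins the two discrepancies \<open>y\<close> and \<open>z\<close>, the four configurations make the same move,
  which either happens in the background or displaces one discrepancy.
\<close>

lemma bond_moves_pair:
  assumes yz: "a \<le> y" "y < z" "z \<le> b" and x: "x \<in> {a..<b}" "\<not> (x = y \<and> z = y + 1)"
  obtains r \<zeta> y' z' where "0 \<le> r" "r \<le> 1" "a \<le> y'" "y' < z'" "z' \<le> b"
    "\<And>i j. bond x f (\<eta>(y := i, z := j)) = r * (f (\<zeta>(y' := i, z' := j)) - f (\<eta>(y := i, z := j)))"
proof -
  have pq1: "p \<le> 1" "q \<le> 1" using p_nonneg q_nonneg pq by auto
  consider "x \<notin> {y - 1, y, z - 1, z}" | "x = y - 1" | "x = y" "z \<noteq> y + 1"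
    | "x = z - 1" "x \<noteq> y" | "x = z" using x(2) by auto
  then show thesis
  proof cases
    case 1
    then have "exchange x (x + 1) (\<eta>(y := i, z := j)) = (exchange x (x + 1) \<eta>)(y := i, z := j)"
      "rate x (\<eta>(y := i, z := j)) = rate x \<eta>" for i j
      using yz by (auto simp: exchange_def fun_eq_iff rate_def)
    then show thesis
      using yz by (intro that[of "rate x \<eta>" y z "exchange x (x + 1) \<eta>"]) (auto simp: bond_def rate_bounds)
  next
    case 2
    \<comment> \<open>One rate serves both values of \<open>i\<close>: if
      \<open>i = \<eta> (y - 1)\<close>, the bond is frozen, but the two configurations on the right
      coincide as well; otherwise the discrepancy hops to \<open>y - 1\<close> and leaves the value
      \<open>\<eta> (y - 1)\<close> at \<open>y\<close>. The other three hops are analogous.\<close>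
    have "bond x f (\<eta>(y := i, z := j)) = (if \<eta> (y - 1) then p else q) *
       (f ((\<eta>(y := \<eta> (y - 1)))(y - 1 := i, z := j)) - f (\<eta>(y := i, z := j)))" for i j
    proof (cases "i = \<eta> (y - 1)")
      case True
      then have "(\<eta>(y := \<eta> (y - 1)))(y - 1 := i, z := j) = \<eta>(y := i, z := j)"
        using yz by (auto simp: fun_eq_iff)
      moreover have "rate x (\<eta>(y := i, z := j)) = 0" using True yz 2 by (simp add: rate_def)
      ultimately show ?thesis by (simp add: bond_def)
    next
      case False
      have "exchange x (x + 1) (\<eta>(y := i, z := j)) = (\<eta>(y := \<eta> (y - 1)))(y - 1 := i, z := j)"
        using yz 2 by (auto simp: fun_eq_iff exchange_def)
      moreover have "rate x (\<eta>(y := i, z := j)) = (if \<eta> (y - 1) then p else q)"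
        using False yz 2 by (auto simp: rate_def)
      ultimately show ?thesis by (simp add: bond_def)
    qed
    then show thesis
      using yz 2 x p_nonneg q_nonneg pq1
      by (intro that[of "if \<eta> (y - 1) then p else q" "y - 1" z "\<eta>(y := \<eta> (y - 1))"]) auto
  next
    case 3
    have "bond x f (\<eta>(y := i, z := j)) = (if \<eta> (y + 1) then q else p) *
       (f ((\<eta>(y := \<eta> (y + 1)))(y + 1 := i, z := j)) - f (\<eta>(y := i, z := j)))" for i j
    proof (cases "i = \<eta> (y + 1)")
      case True
      then have "(\<eta>(y := \<eta> (y + 1)))(y + 1 := i, z := j) = \<eta>(y := i, z := j)"
        using yz by (auto simp: fun_eq_iff)
      moreover have "rate x (\<eta>(y := i, z := j)) = 0" using True yz 3 by (simp add: rate_def)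
      ultimately show ?thesis by (simp add: bond_def)
    next
      case False
      have "exchange x (x + 1) (\<eta>(y := i, z := j)) = (\<eta>(y := \<eta> (y + 1)))(y + 1 := i, z := j)"
        using yz 3 by (auto simp: fun_eq_iff exchange_def)
      moreover have "rate x (\<eta>(y := i, z := j)) = (if \<eta> (y + 1) then q else p)"
        using False yz 3 by (auto simp: rate_def)
      ultimately show ?thesis by (simp add: bond_def)
    qed
    then show thesis
      using yz 3 x p_nonneg q_nonneg pq1
      by (intro that[of "if \<eta> (y + 1) then q else p" "y + 1" z "\<eta>(y := \<eta> (y + 1))"]) auto
  next
    case 4
    have "bond x f (\<eta>(y := i, z := j)) = (if \<eta> (z - 1) then p else q) *
       (f ((\<eta>(z := \<eta> (z - 1)))(y := i, z - 1 := j)) - f (\<eta>(y := i, z := j)))" for i j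
    proof (cases "j = \<eta> (z - 1)")
      case True
      then have "(\<eta>(z := \<eta> (z - 1)))(y := i, z - 1 := j) = \<eta>(y := i, z := j)"
        using yz 4 by (auto simp: fun_eq_iff)
      moreover have "rate x (\<eta>(y := i, z := j)) = 0" using True yz 4 by (simp add: rate_def)
      ultimately show ?thesis by (simp add: bond_def)
    next
      case False
      have "exchange x (x + 1) (\<eta>(y := i, z := j)) = (\<eta>(z := \<eta> (z - 1)))(y := i, z - 1 := j)"
        using yz 4 by (auto simp: fun_eq_iff exchange_def)
      moreover have "rate x (\<eta>(y := i, z := j)) = (if \<eta> (z - 1) then p else q)"
        using False yz 4 by (auto simp: rate_def)
      ultimately show ?thesis by (simp add: bond_def)
    qed
    then show thesis
      using yz 4 x p_nonneg q_nonneg pq1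
      by (intro that[of "if \<eta> (z - 1) then p else q" y "z - 1" "\<eta>(z := \<eta> (z - 1))"]) auto
  next
    case 5
    have "bond x f (\<eta>(y := i, z := j)) = (if \<eta> (z + 1) then q else p) *
       (f ((\<eta>(z := \<eta> (z + 1)))(y := i, z + 1 := j)) - f (\<eta>(y := i, z := j)))" for i j
    proof (cases "j = \<eta> (z + 1)")
      case True
      then have "(\<eta>(z := \<eta> (z + 1)))(y := i, z + 1 := j) = \<eta>(y := i, z := j)"
        using yz 5 by (auto simp: fun_eq_iff)
      moreover have "rate x (\<eta>(y := i, z := j)) = 0" using True yz 5 by (simp add: rate_def)
      ultimately show ?thesis by (simp add: bond_def)
    next
      case False
      have "exchange x (x + 1) (\<eta>(y := i, z := j)) = (\<eta>(z := \<eta> (z + 1)))(y := i, z + 1 := j)"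
        using yz 5 by (auto simp: fun_eq_iff exchange_def)
      moreover have "rate x (\<eta>(y := i, z := j)) = (if \<eta> (z + 1) then q else p)"
        using False yz 5 by (auto simp: rate_def)
      ultimately show ?thesis by (simp add: bond_def)
    qed
    then show thesis
      using yz 5 x p_nonneg q_nonneg pq1
      by (intro that[of "if \<eta> (z + 1) then q else p" y "z + 1" "\<eta>(z := \<eta> (z + 1))"]) auto
  qed
qed

lemma bond_adjacent:
  assumes "z = y + 1"
  shows "bond y f (\<eta>(y := True, z := False)) = p * (f (\<eta>(y := False, z := True)) - f (\<eta>(y := True, z := False)))"
    and "bond y f (\<eta>(y := False, z := True)) = q * (f (\<eta>(y := True, z := False)) - f (\<eta>(y := False, z := True)))"
    and "bond y f (\<eta>(y := i, z := i)) = 0"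
proof -
  have "exchange y z (\<eta>(y := True, z := False)) = \<eta>(y := False, z := True)"
    "exchange y z (\<eta>(y := False, z := True)) = \<eta>(y := True, z := False)"
    using assms by (auto simp: exchange_def fun_eq_iff)
  then show "bond y f (\<eta>(y := True, z := False)) = p * (f (\<eta>(y := False, z := True)) - f (\<eta>(y := True, z := False)))"
    and "bond y f (\<eta>(y := False, z := True)) = q * (f (\<eta>(y := True, z := False)) - f (\<eta>(y := False, z := True)))"
    and "bond y f (\<eta>(y := i, z := i)) = 0"
    using assms by (simp_all add: bond_def rate_def)
qed

text \<open>
  Minimum principle: by the previous lemma only the bond joining the two discrepancies
  has to be examined.
\<close>

lemma quad_euler_nonneg:
  assumes h: "0 \<le> h" "h * real_of_int (b - a) \<le> 1"
    and pos: "\<And>\<eta> y z. a \<le> y \<Longrightarrow> y < z \<Longrightarrow> z \<le> b \<Longrightarrow> 0 \<le> s * quad c d f \<eta> y z"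
    and adj: "\<And>\<eta> y. a \<le> y \<Longrightarrow> y + 1 \<le> b \<Longrightarrow>
      0 \<le> s * quad c d f \<eta> y (y + 1) + s * quad c d (bond y f) \<eta> y (y + 1)"
    and yz: "a \<le> y" "y < z" "z \<le> b"
  shows "0 \<le> s * quad c d (euler a b h f) \<eta> y z"
proof -
  let ?Q = "s * quad c d f \<eta> y z"
  \<comment> \<open>No single bond can lower the value by more than \<open>?Q\<close>, either by
    \<open>adj\<close> or because it moves to a non-negative value at rate at most 1. Weighted by
    \<open>h\<close>, the \<open>b - a\<close> bonds then lower it by at most \<open>?Q\<close>
    altogether.\<close>
  have "- ?Q \<le> s * quad c d (bond x f) \<eta> y z" if x: "x \<in> {a..<b}" for x
  proof (cases "x = y \<and> z = y + 1")
    case True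
    then show ?thesis using adj[of y \<eta>] yz by auto
  next
    case False
    obtain r y' z' \<zeta> where r: "0 \<le> r" "r \<le> 1"
      and yz': "a \<le> y'" "y' < z'" "z' \<le> b"
      and eq: "\<And>i j. bond x f (\<eta>(y := i, z := j)) = r * (f (\<zeta>(y' := i, z' := j)) - f (\<eta>(y := i, z := j)))"
      by (rule bond_moves_pair[OF yz x False, where f = f and \<eta> = \<eta>]) (rule that)
    have Q: "quad c d (bond x f) \<eta> y z = r * (quad c d f \<zeta> y' z' - quad c d f \<eta> y z)"
      unfolding quad_def eq by (simp add: algebra_simps)
    have "s * quad c d (bond x f) \<eta> y z = r * (s * quad c d f \<zeta> y' z') - r * ?Q"
      unfolding Q by (simp add: algebra_simps)
    moreover have "0 \<le> r * (s * quad c d f \<zeta> y' z')" using r pos[OF yz'] by simp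
    moreover have "r * ?Q \<le> ?Q" using r pos[OF yz] by (simp add: mult_left_le_one_le)
    ultimately show ?thesis by linarith
  qed
  then have "(\<Sum>x\<in>{a..<b}. - ?Q) \<le> (\<Sum>x\<in>{a..<b}. s * quad c d (bond x f) \<eta> y z)"
    by (intro sum_mono) auto
  then have "h * - (real_of_int (b - a) * ?Q) \<le> h * (\<Sum>x\<in>{a..<b}. s * quad c d (bond x f) \<eta> y z)"
    using h yz by (intro mult_left_mono) auto
  moreover have "h * real_of_int (b - a) * ?Q \<le> 1 * ?Q"
    using h pos[OF yz] by (intro mult_right_mono) auto
  ultimately show ?thesis
    unfolding quad_euler by (simp add: algebra_simps sum_distrib_left)
qed

text \<open>
  When the two discrepancies are adjacent, the two middle configurations coalesce to the right at
  rate \<open>p\<close> and to the left at rate \<open>q\<close>; \<open>quad (2 * q) (2 * p)\<close> is the value after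
  coalescence, averaged over the side.
\<close>

lemma quad_euler_pow_nonneg:
  assumes h: "0 \<le> h" "h * real_of_int (b - a) \<le> 1"
    and g: "\<And>\<eta> y z. a \<le> y \<Longrightarrow> y < z \<Longrightarrow> z \<le> b \<Longrightarrow> 0 \<le> s * quad (2 * q) (2 * p) g \<eta> y z"
    and g1: "\<And>\<eta> y z. a \<le> y \<Longrightarrow> y < z \<Longrightarrow> z \<le> b \<Longrightarrow> 0 \<le> s * quad 1 1 g \<eta> y z"
    and yz: "a \<le> y" "y < z" "z \<le> b"
  shows "0 \<le> s * quad 1 1 ((euler a b h ^^ n) g) \<eta> y z"
proof -
  let ?U = "\<lambda>n. (euler a b h ^^ n) g"
  \<comment> \<open>The weights \<open>q\<close> on 10 and \<open>p\<close> on 01 are in detailed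
    balance with the exchange of an adjacent pair. The adjacent bond therefore contributes 0, and
    this weighted form propagates by itself.\<close>
  have K: "a \<le> y \<Longrightarrow> y < z \<Longrightarrow> z \<le> b \<Longrightarrow> 0 \<le> s * quad (2 * q) (2 * p) (?U n) \<eta> y z" for n \<eta> y z
  proof (induction n arbitrary: \<eta> y z)
    case (Suc n)
    have "0 \<le> s * quad (2 * q) (2 * p) (euler a b h (?U n)) \<eta> y z"
    proof (rule quad_euler_nonneg[OF h Suc.IH _ Suc.prems], assumption+)
      fix \<eta> y assume "a \<le> y" "y + 1 \<le> b"
      moreover have "quad (2 * q) (2 * p) (bond y (?U n)) \<eta> y (y + 1) = 0"
        unfolding quad_def bond_adjacent[OF refl] by (simp add: algebra_simps)
      ultimately show "0 \<le> s * quad (2 * q) (2 * p) (?U n) \<eta> y (y + 1)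
          + s * quad (2 * q) (2 * p) (bond y (?U n)) \<eta> y (y + 1)"
        using Suc.IH[of y "y + 1" \<eta>] by simp
    qed
    then show ?case by simp
  qed (use g in auto)
  show ?thesis
    using yz
  proof (induction n arbitrary: \<eta> y z)
    case (Suc n)
    have "0 \<le> s * quad 1 1 (euler a b h (?U n)) \<eta> y z"
    proof (rule quad_euler_nonneg[OF h Suc.IH _ Suc.prems], assumption+)
      fix \<eta> y assume y: "a \<le> y" "y + 1 \<le> b"
      have pq': "2 * q = 1 - p + q" "2 * p = 1 + p - q" using pq by auto
      \<comment> \<open>The adjacent bond turns the weights 1 and 1 into \<open>1 - p + q\<close>
        and \<open>1 + p - q\<close>, whose sign is known from \<open>K\<close>.\<close>
      have "quad 1 1 (?U n) \<eta> y (y + 1) + quad 1 1 (bond y (?U n)) \<eta> y (y + 1)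
          = quad (2 * q) (2 * p) (?U n) \<eta> y (y + 1)"
        unfolding quad_def bond_adjacent[OF refl] pq' by (simp add: algebra_simps)
      then show "0 \<le> s * quad 1 1 (?U n) \<eta> y (y + 1) + s * quad 1 1 (bond y (?U n)) \<eta> y (y + 1)"
        using K[of y "y + 1" n \<eta>] y by (simp flip: distrib_left)
    qed
    then show ?case by simp
  qed (use g1 in auto)
qed

text \<open>The coalesced value is initially \<open>(p - q) * (g z - g y)\<close>; a further factor
  \<open>p - q\<close> makes its sign independent of the direction of the drift.\<close>

lemma quad_euler_pow_moment:
  assumes h: "0 \<le> h" "h * real_of_int (b - a) \<le> 1" and g: "mono g"
    and yz: "a \<le> y" "y < z" "z \<le> b"
  shows "0 \<le> (p - q) * quad 1 1 ((euler a b h ^^ n) (moment a b g)) \<eta> y z"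
proof (rule quad_euler_pow_nonneg[OF h _ _ yz])
  fix \<eta> y z assume *: "a \<le> y" "y < z" "z \<le> b"
  have pq': "2 * q = 1 - p + q" "2 * p = 1 + p - q" using pq by auto
  have "(p - q) * quad (2 * q) (2 * p) (moment a b g) \<eta> y z = (p - q)\<^sup>2 * (g z - g y)"
    unfolding quad_moment[OF *] pq' by (simp add: power2_eq_square algebra_simps)
  then show "0 \<le> (p - q) * quad (2 * q) (2 * p) (moment a b g) \<eta> y z"
    using g * by (simp add: monoD)
  show "0 \<le> (p - q) * quad 1 1 (moment a b g) \<eta> y z"
    unfolding quad_moment[OF *] by simp
qed

text \<open>Exchanges inside the closed box conserve the number of particles.\<close>

lemma euler_pow_moment_const:
  "(euler a b h ^^ n) (moment a b (\<lambda>_. 1)) = moment a b (\<lambda>_. 1)"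
proof -
  have "bond x (moment a b (\<lambda>_. 1)) \<eta> = 0" if "x \<in> {a..<b}" for x \<eta>
  proof -
    have upd: "moment a b (\<lambda>_. 1) (\<eta>(x := i, x + 1 := j))
      = moment a b (\<lambda>_. 1) (\<eta>(x := False, x + 1 := False)) + of_bool i + of_bool j" for i j
      using moment_upd2[of a x "x + 1" b "\<lambda>_. 1" \<eta> i j] that by (simp only: mult_1) auto
    show ?thesis
      using upd[of "\<eta> x" "\<eta> (x + 1)"] upd[of "\<eta> (x + 1)" "\<eta> x"]
      by (simp add: bond_def exchange_def)
  qed
  then have "euler a b h (moment a b (\<lambda>_. 1)) = moment a b (\<lambda>_. 1)"
    by (simp add: euler_def box_gen_def fun_eq_iff)
  then show ?thesis by (induction n) auto
qed

lemma euler_pow_moment: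
  "(euler a b h ^^ n) (moment a b g) \<eta> = (\<Sum>x\<in>{a..b}. g x * (euler a b h ^^ n) (occ x) \<eta>)"
  using euler_pow_sum[where I = "{a..b}" and g = g and f = occ] unfolding moment_def by metis

end

section \<open>Semigroup and Euler scheme\<close>

text \<open>\<open>Bcontfun\<close> is total but meaningful only on bounded continuous functions;
  \<open>apply_obs\<close> supplies this for functions of finitely many sites.\<close>

definition obs :: "(config \<Rightarrow> real) \<Rightarrow> observable" where
  "obs f = Bcontfun f"

lemma open_cylinder_set:
  assumes "finite A"
  shows "open {\<zeta> :: config. \<forall>x\<in>A. \<zeta> x = \<eta> x}"
proof -
  have "open ((\<lambda>\<zeta> :: config. \<zeta> x) -` {\<eta> x})" for x
    by (intro open_vimage continuous_on_product_coordinates Topological_Spaces.open_discrete)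
  moreover have "{\<zeta> :: config. \<forall>x\<in>A. \<zeta> x = \<eta> x} = (\<Inter>x\<in>A. (\<lambda>\<zeta>. \<zeta> x) -` {\<eta> x})"
    by auto
  ultimately show ?thesis using assms by auto
qed

text \<open>Every preimage is a union of open cylinder sets, and at most one value occurs for each
  subset of \<open>A\<close>.\<close>

lemma depends_on_bcontfun:
  assumes "depends_on f A" "finite A"
  shows "f \<in> bcontfun"
proof -
  have "continuous_on UNIV f"
    unfolding continuous_on_open_vimage[OF open_UNIV]
  proof (intro allI impI)
    fix B :: "real set"
    have "f -` B = (\<Union>\<eta>\<in>f -` B. {\<zeta>. \<forall>x\<in>A. \<zeta> x = \<eta> x})"
      using assms(1) by (auto simp: depends_on_def)
    also have "open \<dots>" using open_cylinder_set[OF assms(2)] by blast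
    finally show "open (f -` B \<inter> UNIV)" by simp
  qed
  moreover have "range f \<subseteq> (\<lambda>S. f (\<lambda>x. x \<in> S)) ` Pow A"
  proof
    fix y assume "y \<in> range f"
    then obtain \<eta> where "y = f \<eta>" by auto
    then have "y = f (\<lambda>x. x \<in> {x \<in> A. \<eta> x})"
      using assms(1) by (auto intro: depends_onD)
    then show "y \<in> (\<lambda>S. f (\<lambda>x. x \<in> S)) ` Pow A" by blast
  qed
  then have "bounded (range f)"
    using assms(2) by (meson finite_Pow_iff finite_imageI finite_imp_bounded finite_subset)
  ultimately show ?thesis by (simp add: bcontfun_def)
qed

lemma apply_obs: "depends_on f A \<Longrightarrow> finite A \<Longrightarrow> apply_bcontfun (obs f) = f"
  unfolding obs_def by (rule Bcontfun_inverse) (rule depends_on_bcontfun)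

lemma apply_obs_occ [simp]: "apply_bcontfun (obs (occ x)) = occ x"
  by (rule apply_obs[of _ "{x}"]) (auto intro: depends_on_occ)

definition shift :: "config \<Rightarrow> config" where
  "shift \<eta> = (\<lambda>x. \<eta> (x + 1))"

locale nn_semigroup =
  fixes jl :: "int pmf" and P :: "real \<Rightarrow> observable \<Rightarrow> observable"
  assumes nn: "nearest_neighbor jl" and semigroup: "exclusion_semigroup jl P"
begin

abbreviation p where "p \<equiv> pmf jl 1"
abbreviation q where "q \<equiv> pmf jl (- 1)"

sublocale nn_rates p q
proof
  have "set_pmf jl \<subseteq> {1, -1}"
  proof
    fix z assume "z \<in> set_pmf jl"
    then have "\<not> \<bar>z\<bar> \<noteq> 1" using nn unfolding nearest_neighbor_def by (auto simp: set_pmf_iff)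
    then show "z \<in> {1, -1}" by auto
  qed
  then show "p + q = 1" using sum_pmf_eq_1[of "{1, -1}" jl] by simp
qed simp_all

text \<open>Only jumps touching \<open>{a..b}\<close> change \<open>f\<close>, and the bonds
  \<open>{x, x + 1}\<close> that do so have \<open>x\<close> between \<open>a - 1\<close> and
  \<open>b\<close>; hence the box grows by one on each side.\<close>

lemma exclusion_operator_eq:
  assumes "depends_on f {a..b}"
  shows "exclusion_operator jl f = box_gen (a - 1) (b + 1) f"
proof
  fix \<eta>
  define T where "T x z = pmf jl z * of_bool (\<eta> x) * (1 - of_bool (\<eta> (x + z)))
        * (f (exchange x (x + z) \<eta>) - f \<eta>)" for x z
  let ?I = "{a - 1..<b + 1}"
  \<comment> \<open>Each bond collects the right jump from \<open>x\<close> and the left jump from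
    \<open>x + 1\<close>.\<close>
  let ?S = "(\<lambda>x. (x, 1)) ` ?I \<union> (\<lambda>x. (x + 1, - 1)) ` ?I"
  have zero: "T x z = 0" if "(x, z) \<notin> ?S" for x z
  proof (cases "\<bar>z\<bar> = 1")
    case False
    then show ?thesis using nn by (simp add: nearest_neighbor_def T_def)
  next
    case True
    then consider "z = 1" | "z = -1" by linarith
    then have "x \<notin> {a..b} \<and> x + z \<notin> {a..b}"
    proof cases
      case 1
      then show ?thesis using that by auto
    next
      case 2
      have "x - 1 \<notin> ?I"
      proof
        assume "x - 1 \<in> ?I"
        then have "(\<lambda>x. (x + 1, - 1 :: int)) (x - 1) \<in> ?S" by blast
        then show False using that 2 by simp
      qed
      then show ?thesis using 2 by auto
    qed
    then have "f (exchange x (x + z) \<eta>) = f \<eta>"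
      by (intro depends_onD[OF assms]) (auto simp: exchange_def)
    then show ?thesis by (simp add: T_def)
  qed
  have "exclusion_operator jl f \<eta> = (\<Sum>\<^sub>\<infinity>(x, z)\<in>UNIV. T x z)"
    unfolding exclusion_operator_def T_def ..
  also have "\<dots> = (\<Sum>\<^sub>\<infinity>(x, z)\<in>?S. T x z)"
    using zero by (intro infsum_cong_neutral) auto
  also have "\<dots> = (\<Sum>(x, z)\<in>?S. T x z)"
    by (intro infsum_finite) auto
  also have "\<dots> = (\<Sum>x\<in>?I. T x 1) + (\<Sum>x\<in>?I. T (x + 1) (- 1))"
    by (subst sum.union_disjoint) (auto simp: sum.reindex inj_on_def)
  also have "\<dots> = (\<Sum>x\<in>?I. bond x f \<eta>)"
    unfolding sum.distrib[symmetric]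
  proof (intro sum.cong refl)
    fix x
    have "exchange (x + 1) x \<eta> = exchange x (x + 1) \<eta>"
      by (auto simp: exchange_def fun_eq_iff)
    then show "T x 1 + T (x + 1) (- 1) = bond x f \<eta>"
      by (auto simp: T_def bond_def rate_def)
  qed
  finally show "exclusion_operator jl f \<eta> = box_gen (a - 1) (b + 1) f \<eta>"
    by (simp add: box_gen_def)
qed

lemma depends_on_box_gen':
  "depends_on f {a..b} \<Longrightarrow> depends_on (box_gen (a - 1) (b + 1) f) {a - 1..b + 1}"
  by (intro depends_on_box_gen) (auto intro: depends_on_mono)

section \<open>Contraction and differentiability of the semigroup\<close>

lemma markov: "markov_semigroup P"
  using semigroup by (simp add: exclusion_semigroup_def)

lemma P_linear: "0 \<le> t \<Longrightarrow> linear (P t)"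
  and P_0 [simp]: "P 0 f = f"
  and P_plus: "0 \<le> s \<Longrightarrow> 0 \<le> t \<Longrightarrow> P (s + t) f = P s (P t f)"
  and P_one: "0 \<le> t \<Longrightarrow> P t (const_bcontfun 1) = const_bcontfun 1"
  and P_pos: "0 \<le> t \<Longrightarrow> (\<And>\<eta>. 0 \<le> apply_bcontfun f \<eta>) \<Longrightarrow> 0 \<le> apply_bcontfun (P t f) \<eta>"
  and P_tendsto: "((\<lambda>t. P t f) \<longlongrightarrow> f) (at_right 0)"
  using markov unfolding markov_semigroup_def by blast+

lemmas P_diff = linear_diff[OF P_linear]
lemmas P_add = linear_add[OF P_linear]
lemmas P_scaleR = linear_scale[OF P_linear]

text \<open>Positivity applied to the constant \<open>norm f\<close> plus and minus
  \<open>f\<close>, with constants preserved.\<close>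

lemma P_norm:
  assumes "0 \<le> t"
  shows "norm (P t f) \<le> norm f"
proof (rule norm_bound)
  fix \<eta>
  define c where "c = norm f *\<^sub>R (const_bcontfun 1 :: observable)"
  have c: "P t c = c" unfolding c_def using assms by (simp add: P_scaleR P_one)
  have le: "\<bar>f \<zeta>\<bar> \<le> norm f" for \<zeta> using norm_bounded[of f \<zeta>] by simp
  have "0 \<le> (c - f) \<zeta>" "0 \<le> (c + f) \<zeta>" for \<zeta>
    using le[of \<zeta>] by (auto simp: c_def)
  then have "0 \<le> P t (c - f) \<eta>" "0 \<le> P t (c + f) \<eta>"
    by (auto intro: P_pos[OF assms])
  then have "\<bar>P t f \<eta>\<bar> \<le> c \<eta>"
    using assms by (simp add: P_diff P_add c)
  then show "norm (P t f \<eta>) \<le> norm f" by (simp add: c_def)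
qed

lemma generator_increment:
  assumes "(f, g) \<in> generator P" "0 < e"
  obtains d where "0 < d" "\<And>h. 0 \<le> h \<Longrightarrow> h < d \<Longrightarrow> norm (P h f - f - h *\<^sub>R g) \<le> e * h"
proof -
  have "((\<lambda>t. (P t f - f) /\<^sub>R t) \<longlongrightarrow> g) (at_right 0)"
    using assms(1) by (simp add: generator_def)
  then have "\<forall>\<^sub>F t in at_right 0. dist ((P t f - f) /\<^sub>R t) g < e"
    using assms(2) by (rule tendstoD)
  then obtain d where d: "0 < d" "\<And>t. 0 < t \<Longrightarrow> t < d \<Longrightarrow> dist ((P t f - f) /\<^sub>R t) g < e"
    by (auto simp: eventually_at_right_field)
  have "norm (P h f - f - h *\<^sub>R g) \<le> e * h" if "0 \<le> h" "h < d" for h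
  proof (cases "h = 0")
    case False
    then have "h > 0" using that by simp
    have "P h f - f - h *\<^sub>R g = h *\<^sub>R ((P h f - f) /\<^sub>R h - g)"
      using \<open>h > 0\<close> by (simp add: scaleR_diff_right)
    then have "norm (P h f - f - h *\<^sub>R g) = h * dist ((P h f - f) /\<^sub>R h) g"
      using \<open>h > 0\<close> by (simp add: dist_norm)
    also have "\<dots> \<le> h * e" using d(2)[of h] that \<open>h > 0\<close> by (intro mult_left_mono) auto
    finally show ?thesis by (simp add: mult.commute)
  qed simp
  then show thesis using d(1) that by blast
qed

text \<open>The definition of the generator is only a right derivative at 0. Contraction carries it
  to the right of \<open>t\<close>; to the left, the extra term
  \<open>P t g - P y g = P y (P h g - g)\<close> is small by strong continuity at 0.\<close>

lemma generator_derivative: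
  assumes fg: "(f, g) \<in> generator P" and t: "0 \<le> t"
  shows "((\<lambda>t. P t f) has_vector_derivative P t g) (at t within {0..})"
  unfolding has_vector_derivative_def has_derivative_within_alt
proof (intro conjI allI impI)
  fix e :: real assume e: "0 < e"
  then have e2: "0 < e / 2" by simp
  obtain d1 where d1: "0 < d1" "\<And>h. 0 \<le> h \<Longrightarrow> h < d1 \<Longrightarrow> norm (P h f - f - h *\<^sub>R g) \<le> e / 2 * h"
    using generator_increment[OF fg e2] by blast
  have "\<forall>\<^sub>F h in at_right 0. dist (P h g) g < e / 2"
    using P_tendsto e2 by (rule tendstoD)
  then obtain d2 where d2: "0 < d2" "\<And>h. 0 < h \<Longrightarrow> h < d2 \<Longrightarrow> dist (P h g) g < e / 2"
    by (auto simp: eventually_at_right_field)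
  have forward: "norm (P (s + h) f - P s f - h *\<^sub>R P s g) \<le> e / 2 * h"
    if "0 \<le> s" "0 \<le> h" "h < d1" for s h
  proof -
    have "P (s + h) f - P s f - h *\<^sub>R P s g = P s (P h f - f - h *\<^sub>R g)"
      using that by (simp add: P_plus P_diff P_scaleR)
    then show ?thesis using P_norm[OF that(1), of "P h f - f - h *\<^sub>R g"] d1(2)[OF that(2,3)] by simp
  qed
  have "norm (P y f - P t f - (y - t) *\<^sub>R P t g) \<le> e * norm (y - t)"
    if y: "0 \<le> y" "norm (y - t) < min d1 d2" for y
  proof (cases "t \<le> y")
    case True
    have "norm (P y f - P t f - (y - t) *\<^sub>R P t g) \<le> e / 2 * (y - t)"
      using forward[of t "y - t"] t y True by simp
    also have "\<dots> \<le> e * norm (y - t)" using True e by simp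
    finally show ?thesis .
  next
    case False
    define h where "h = t - y"
    have h: "0 < h" "h < d1" "h < d2" "t = y + h"
      using y False by (auto simp: h_def)
    have "norm (P t f - P y f - h *\<^sub>R P y g) \<le> e / 2 * h"
      using forward[of y h] y h by simp
    moreover have "norm (h *\<^sub>R (P t g - P y g)) \<le> e / 2 * h"
    proof -
      have "P t g - P y g = P y (P h g - g)"
        using h y by (simp add: P_plus P_diff)
      then have "norm (P t g - P y g) \<le> e / 2"
        using P_norm[OF y(1), of "P h g - g"] d2(2)[of h] h by (simp add: dist_norm)
      then show ?thesis using h by simp
    qed
    moreover have "P y f - P t f - (y - t) *\<^sub>R P t g
       = - (P t f - P y f - h *\<^sub>R P y g) + h *\<^sub>R (P t g - P y g)"
      using h(4) by (simp add: algebra_simps)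
    ultimately have "norm (P y f - P t f - (y - t) *\<^sub>R P t g) \<le> e / 2 * h + e / 2 * h"
      by (metis norm_minus_cancel norm_triangle_mono)
    then show ?thesis using h by simp
  qed
  then show "\<exists>d>0. \<forall>y\<in>{0..}. norm (y - t) < d \<longrightarrow> norm (P y f - P t f - (y - t) *\<^sub>R P t g) \<le> e * norm (y - t)"
    using d1(1) d2(1) by (intro exI[of _ "min d1 d2"]) auto
qed (simp add: bounded_linear_scaleR_left)

lemma vector_increment_le:
  fixes \<phi> :: "real \<Rightarrow> observable"
  assumes "0 \<le> h" "\<And>t. 0 \<le> t \<Longrightarrow> (\<phi> has_vector_derivative \<phi>' t) (at t within {0..})"
    and "\<And>t. 0 \<le> t \<Longrightarrow> t \<le> h \<Longrightarrow> norm (\<phi>' t) \<le> B"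
  shows "norm (\<phi> h - \<phi> 0) \<le> B * h"
proof -
  have "norm (\<phi> h - \<phi> 0) \<le> B * norm (h - 0)"
  proof (rule differentiable_bound[of "{0..h}" \<phi> "\<lambda>t x. x *\<^sub>R \<phi>' t"])
    fix t assume t: "t \<in> {0..h}"
    then show "(\<phi> has_derivative (\<lambda>x. x *\<^sub>R \<phi>' t)) (at t within {0..h})"
      using assms(2)[of t] unfolding has_vector_derivative_def
      by (auto intro: has_derivative_subset)
    have "norm (x *\<^sub>R \<phi>' t) \<le> B * norm x" for x
      using mult_right_mono[OF assms(3)[of t], of "norm x"] t by (simp add: mult.commute)
    moreover have "0 \<le> B"
      using assms(3)[of t] t by (intro order_trans[OF norm_ge_zero[of "\<phi>' t"]]) auto
    ultimately show "onorm (\<lambda>x. x *\<^sub>R \<phi>' t) \<le> B" by (intro onorm_bound)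
  qed (use assms(1) in auto)
  then show ?thesis using assms(1) by simp
qed

lemma generator_norm_bound:
  assumes "(f, g) \<in> generator P" "0 \<le> h"
  shows "norm (P h f - f) \<le> norm g * h"
  using vector_increment_le[OF assms(2), of "\<lambda>t. P t f" "\<lambda>t. P t g" "norm g"]
    generator_derivative[OF assms(1)] P_norm by simp

text \<open>Taylor bound for \<open>f\<close> in the domain of the squared generator, which contains
  the cylinder functions. The remainder has derivative \<open>P t g - g\<close>, of norm at most
  \<open>norm k * t\<close>.\<close>

lemma generator_second_order:
  assumes fg: "(f, g) \<in> generator P" and gk: "(g, k) \<in> generator P" and h: "0 \<le> h"
  shows "norm (P h f - f - h *\<^sub>R g) \<le> norm k * h\<^sup>2"
proof -
  let ?\<phi> = "\<lambda>t. P t f - t *\<^sub>R g"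
  have "norm (?\<phi> h - ?\<phi> 0) \<le> (norm k * h) * h"
  proof (rule vector_increment_le[OF h])
    fix t :: real assume t: "0 \<le> t"
    show "(?\<phi> has_vector_derivative (P t g - g)) (at t within {0..})"
      using generator_derivative[OF fg t] by (auto intro!: derivative_eq_intros)
    assume "t \<le> h"
    then show "norm (P t g - g) \<le> norm k * h"
      using generator_norm_bound[OF gk t] by (meson mult_left_mono norm_ge_zero order_trans)
  qed
  then show ?thesis by (simp add: power2_eq_square mult.assoc algebra_simps)
qed

section \<open>Convergence of the Euler scheme to the semigroup\<close>

lemma cylinder_generator:
  assumes "depends_on f {a..b}"
  shows "(obs f, obs (box_gen (a - 1) (b + 1) f)) \<in> generator P"
proof -
  have "apply_bcontfun (obs f) = f" "apply_bcontfun (obs (box_gen (a - 1) (b + 1) f)) = box_gen (a - 1) (b + 1) f"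
    using assms depends_on_box_gen'[OF assms] by (auto intro: apply_obs)
  then have "(obs f, obs (box_gen (a - 1) (b + 1) f)) \<in> exclusion_pregenerator jl"
    using assms exclusion_operator_eq[OF assms]
    by (auto simp: exclusion_pregenerator_def cylinder_def depends_on_def intro!: exI[of _ "{a..b}"])
  then show ?thesis
    using semigroup closure_subset unfolding exclusion_semigroup_def by blast
qed

lemma box_gen_bound:
  assumes "\<And>\<eta>. \<bar>f \<eta>\<bar> \<le> c" "a \<le> b"
  shows "\<bar>box_gen a b f \<eta>\<bar> \<le> 2 * c * real_of_int (b - a)"
proof -
  have "\<bar>bond x f \<eta>\<bar> \<le> 2 * c" for x
  proof -
    have "\<bar>f (exchange x (x + 1) \<eta>) - f \<eta>\<bar> \<le> 2 * c"
      using assms(1)[of \<eta>] assms(1)[of "exchange x (x + 1) \<eta>"] by linarith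
    then have "\<bar>bond x f \<eta>\<bar> \<le> 1 * (2 * c)"
      unfolding bond_def abs_mult by (intro mult_mono) (auto simp: rate_bounds)
    then show ?thesis by simp
  qed
  then have "\<bar>box_gen a b f \<eta>\<bar> \<le> (\<Sum>x\<in>{a..<b}. 2 * c)"
    unfolding box_gen_def by (intro order_trans[OF sum_abs] sum_mono)
  then show ?thesis using assms(2) by (simp add: mult.commute)
qed

text \<open>Two errors add up: the Taylor remainder, where applying the generator twice costs the
  squared box length, and the two cut bonds, each worth the influence of one end site.\<close>

lemma euler_step_error:
  assumes f: "depends_on f {a..b}" "\<And>\<eta>. \<bar>f \<eta>\<bar> \<le> 1" and h: "0 \<le> h" and ab: "a \<le> b"
    and m: "\<And>y \<eta>. \<bar>f (\<eta>(y := True)) - f (\<eta>(y := False))\<bar> \<le> m y"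
  shows "norm (P h (obs f) - obs (euler a b h f)) \<le> h * (m a + m b) + 4 * h\<^sup>2 * (real_of_int (b - a) + 4)\<^sup>2"
proof -
  define g where "g = box_gen (a - 1) (b + 1) f"
  define k where "k = box_gen (a - 2) (b + 2) g"
  let ?l = "real_of_int (b - a)"
  have dg: "depends_on g {a - 1..b + 1}" unfolding g_def by (rule depends_on_box_gen'[OF f(1)])
  have dk: "depends_on k {a - 2..b + 2}"
    using depends_on_box_gen'[OF dg] by (simp add: k_def add.commute[of 2])
  have ag: "apply_bcontfun (obs g) = g" and ak: "apply_bcontfun (obs k) = k"
    and af: "apply_bcontfun (obs f) = f"
    and au: "apply_bcontfun (obs (euler a b h f)) = euler a b h f"
    using dg dk f(1) depends_on_euler[OF f(1)] by (auto intro: apply_obs)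
  have gb: "\<bar>g \<eta>\<bar> \<le> 2 * (?l + 2)" for \<eta>
    using box_gen_bound[of f 1 "a - 1" "b + 1" \<eta>] f(2) ab unfolding g_def by simp
  have nk: "norm (obs k) \<le> 4 * (?l + 4)\<^sup>2"
  proof (rule norm_bound)
    fix \<eta>
    have "\<bar>k \<eta>\<bar> \<le> 2 * (2 * (?l + 2)) * (?l + 4)"
      using box_gen_bound[of g "2 * (?l + 2)" "a - 2" "b + 2" \<eta>] gb ab unfolding k_def by (simp add: algebra_simps)
    also have "\<dots> \<le> 2 * (2 * (?l + 4)) * (?l + 4)"
      using ab by (intro mult_right_mono) auto
    also have "\<dots> = 4 * (?l + 4)\<^sup>2" by (simp add: power2_eq_square)
    finally show "norm (obs k \<eta>) \<le> 4 * (?l + 4)\<^sup>2" by (simp add: ak)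
  qed
  have gen: "(obs f, obs g) \<in> generator P" "(obs g, obs k) \<in> generator P"
    using cylinder_generator[OF f(1)] cylinder_generator[OF dg] by (simp_all add: g_def k_def add.commute[of 2])
  have "norm (P h (obs f) - obs f - h *\<^sub>R obs g) \<le> norm (obs k) * h\<^sup>2"
    by (rule generator_second_order[OF gen h])
  also have "\<dots> \<le> 4 * (?l + 4)\<^sup>2 * h\<^sup>2" using nk by (rule mult_right_mono) simp
  finally have 1: "norm (P h (obs f) - obs f - h *\<^sub>R obs g) \<le> 4 * h\<^sup>2 * (?l + 4)\<^sup>2"
    by (simp add: mult_ac)
  have 2: "norm (obs f + h *\<^sub>R obs g - obs (euler a b h f)) \<le> h * (m a + m b)"
  proof (rule norm_bound)
    fix \<eta>
    have edge: "\<bar>bond x f \<eta>\<bar> \<le> d"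
      if "\<bar>f (exchange x (x + 1) \<eta>) - f \<eta>\<bar> \<le> d" for x d
    proof -
      have "\<bar>bond x f \<eta>\<bar> \<le> 1 * d"
        unfolding bond_def abs_mult using that by (intro mult_mono) (auto simp: rate_bounds)
      then show ?thesis by simp
    qed
    \<comment> \<open>\<open>f\<close> does not see the site \<open>b + 1\<close>, so exchanging
      across the cut bond acts on it as a flip at \<open>b\<close>.\<close>
    have "f (exchange b (b + 1) \<eta>) = f (\<eta>(b := \<eta> (b + 1)))"
      by (rule depends_onD[OF f(1)]) (auto simp: exchange_def)
    then have "\<bar>bond b f \<eta>\<bar> \<le> m b" using flip_bound[of f b "m b", OF m] by (intro edge) simp
    moreover have "f (exchange (a - 1) a \<eta>) = f (\<eta>(a := \<eta> (a - 1)))"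
      by (rule depends_onD[OF f(1)]) (auto simp: exchange_def)
    then have "\<bar>bond (a - 1) f \<eta>\<bar> \<le> m a" using flip_bound[of f a "m a", OF m] by (intro edge) simp
    moreover have "g \<eta> = bond (a - 1) f \<eta> + box_gen a b f \<eta> + bond b f \<eta>"
    proof -
      have "{a - 1..<b + 1} = insert (a - 1) (insert b {a..<b})" using ab by auto
      then show ?thesis using ab by (simp add: g_def box_gen_def)
    qed
    ultimately have "\<bar>g \<eta> - box_gen a b f \<eta>\<bar> \<le> m a + m b" by linarith
    then have "\<bar>h * (g \<eta> - box_gen a b f \<eta>)\<bar> \<le> h * (m a + m b)"
      using h by (simp add: abs_mult mult_left_mono)
    then show "norm ((obs f + h *\<^sub>R obs g - obs (euler a b h f)) \<eta>) \<le> h * (m a + m b)"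
      by (simp add: af ag au euler_def algebra_simps)
  qed
  have "P h (obs f) - obs (euler a b h f)
      = (P h (obs f) - obs f - h *\<^sub>R obs g) + (obs f + h *\<^sub>R obs g - obs (euler a b h f))"
    by simp
  then show ?thesis using 1 2 norm_triangle_mono by (metis add.commute)
qed

text \<open>Local errors merely add, since \<open>P h\<close> is a contraction. The influence bound
  holds at every intermediate step, so the cut bonds cost an amount exponentially small in the
  distance from \<open>x\<close> to the ends, and the Taylor remainders sum to order
  \<open>1 / n\<close>.\<close>

lemma euler_approximation:
  assumes t: "0 \<le> t" and n: "0 < n" "t / real n * real_of_int (b - a) \<le> 1" and x: "a \<le> x" "x \<le> b"
  shows "\<bar>P t (obs (occ x)) \<eta> - (euler a b (t / n) ^^ n) (occ x) \<eta>\<bar>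
    \<le> t * exp (6 * t) * ((1/2) ^ nat (x - a) + (1/2) ^ nat (b - x))
      + 4 * t\<^sup>2 * (real_of_int (b - a) + 4)\<^sup>2 / n"
proof -
  define h where "h = t / n"
  have ab: "a \<le> b" using x by simp
  have h: "0 \<le> h" "h * real_of_int (b - a) \<le> 1" using t n by (auto simp: h_def)
  define m where "m y = exp (6 * t) * (1/2::real) ^ nat \<bar>y - x\<bar>" for y
  define \<delta> where "\<delta> = h * (m a + m b) + 4 * h\<^sup>2 * (real_of_int (b - a) + 4)\<^sup>2"
  let ?U = "\<lambda>k. (euler a b h ^^ k) (occ x)"
  have dep: "depends_on (?U k) {a..b}" for k
    using x by (intro depends_on_euler_pow depends_on_occ) auto
  have "norm (P (real k * h) (obs (occ x)) - obs (?U k)) \<le> real k * \<delta>" if "k \<le> n" for k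
    using that
  proof (induction k)
    case (Suc k)
    have "\<bar>?U k \<zeta>\<bar> \<le> 1" for \<zeta>
      using euler_pow_bounds[OF h ab, of 0 "occ x" 1 k \<zeta>] by (auto simp: occ_def)
    then have "norm (P h (obs (?U k)) - obs (euler a b h (?U k))) \<le> \<delta>"
      unfolding \<delta>_def
      by (intro euler_step_error dep h ab) 
        (use euler_pow_occ_flip_exp[of t n b a k x] t n ab Suc.prems in \<open>auto simp: h_def m_def\<close>)
    moreover have "norm (P h (P (real k * h) (obs (occ x)) - obs (?U k))) \<le> real k * \<delta>"
      using Suc P_norm[OF h(1), of "P (real k * h) (obs (occ x)) - obs (?U k)"] by simp
    moreover have "P (real (Suc k) * h) (obs (occ x)) - obs (?U (Suc k))
      = P h (P (real k * h) (obs (occ x)) - obs (?U k)) + (P h (obs (?U k)) - obs (euler a b h (?U k)))"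
      using P_plus[of h "real k * h"] h(1) by (simp add: P_diff algebra_simps)
    ultimately have "norm (P (real (Suc k) * h) (obs (occ x)) - obs (?U (Suc k))) \<le> real k * \<delta> + \<delta>"
      by (metis norm_triangle_mono)
    then show ?case by (simp add: algebra_simps)
  qed simp
  from this[of n] have "norm (P t (obs (occ x)) - obs (?U n)) \<le> real n * \<delta>"
    using n by (simp add: h_def)
  moreover have "apply_bcontfun (obs (?U n)) = ?U n" using dep by (auto intro: apply_obs)
  ultimately have "\<bar>P t (obs (occ x)) \<eta> - ?U n \<eta>\<bar> \<le> real n * \<delta>"
    using norm_bounded[of "P t (obs (occ x)) - obs (?U n)" \<eta>] by simp
  moreover have "real n * \<delta> = t * (m a + m b) + 4 * t\<^sup>2 * (real_of_int (b - a) + 4)\<^sup>2 / n"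
    using n unfolding \<delta>_def h_def by (simp add: field_simps power2_eq_square)
  moreover have "m a + m b = exp (6 * t) * ((1/2) ^ nat (x - a) + (1/2) ^ nat (b - x))"
    using x unfolding m_def by (simp add: algebra_simps)
  ultimately show ?thesis by (simp add: h_def mult.assoc)
qed

text \<open>With radius \<open>k\<close> and \<open>k ^ 4\<close> steps, the step condition is of
  order \<open>k / k ^ 4\<close> and the remainder of order \<open>k\<^sup>2 / k ^ 4\<close>; both
  vanish.\<close>

lemma euler_tendsto:
  assumes t: "0 \<le> t"
  shows "(\<lambda>k. (euler (x - int k) (x + int k) (t / real (k ^ 4)) ^^ (k ^ 4)) (occ x) \<eta>)
    \<longlonglongrightarrow> P t (obs (occ x)) \<eta>"
proof (rule LIM_zero_cancel, rule tendsto_rabs_zero_cancel, rule tendsto_sandwich[OF always_eventually])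
  let ?B = "\<lambda>k::nat. t * exp (6 * t) * (2 * (1/2) ^ k) + 4 * t\<^sup>2 * ((2 * real k + 4)\<^sup>2 / real k ^ 4)"
  show "\<forall>k. 0 \<le> \<bar>(euler (x - int k) (x + int k) (t / real (k ^ 4)) ^^ (k ^ 4)) (occ x) \<eta>
      - P t (obs (occ x)) \<eta>\<bar>" by simp
  have "(\<lambda>k::nat. (1/2::real) ^ k) \<longlonglongrightarrow> 0" by real_asymp
  moreover have "(\<lambda>k::nat. (2 * real k + 4)\<^sup>2 / real k ^ 4) \<longlonglongrightarrow> 0" by real_asymp
  ultimately show "?B \<longlonglongrightarrow> 0"
    by (intro tendsto_add_zero tendsto_mult_right_zero)
  have "(\<lambda>k::nat. t * (2 * real k / real k ^ 4)) \<longlonglongrightarrow> t * 0"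
    by (rule tendsto_mult_left) real_asymp
  then have "\<forall>\<^sub>F k::nat in sequentially. t * (2 * real k / real k ^ 4) < 1"
    by (rule order_tendstoD) simp
  then show "\<forall>\<^sub>F k in sequentially. \<bar>(euler (x - int k) (x + int k) (t / real (k ^ 4)) ^^ (k ^ 4)) (occ x) \<eta>
      - P t (obs (occ x)) \<eta>\<bar> \<le> ?B k"
    using eventually_gt_at_top[of "0::nat"]
  proof eventually_elim
    case (elim k)
    then show ?case
      using euler_approximation[of t "k ^ 4" "x + int k" "x - int k" x \<eta>] t
      by (simp add: abs_minus_commute mult_ac)
  qed
qed simp

lemma P_occ_flip:
  assumes "0 \<le> t"
  shows "\<bar>P t (obs (occ x)) (\<eta>(y := True)) - P t (obs (occ x)) (\<eta>(y := False))\<bar>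
    \<le> exp (6 * t) * (1/2) ^ nat \<bar>y - x\<bar>"
proof (rule tendsto_upperbound[OF tendsto_rabs[OF tendsto_diff[OF euler_tendsto euler_tendsto]]])
  have "(\<lambda>k::nat. t * (2 * real k / real k ^ 4)) \<longlonglongrightarrow> t * 0"
    by (rule tendsto_mult_left) real_asymp
  then have "\<forall>\<^sub>F k::nat in sequentially. t * (2 * real k / real k ^ 4) < 1"
    by (rule order_tendstoD) simp
  then show "\<forall>\<^sub>F k in sequentially.
      \<bar>(euler (x - int k) (x + int k) (t / real (k ^ 4)) ^^ (k ^ 4)) (occ x) (\<eta>(y := True)) -
       (euler (x - int k) (x + int k) (t / real (k ^ 4)) ^^ (k ^ 4)) (occ x) (\<eta>(y := False))\<bar>
      \<le> exp (6 * t) * (1/2) ^ nat \<bar>y - x\<bar>"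
    using eventually_gt_at_top[of "0::nat"]
  proof eventually_elim
    case (elim k)
    then show ?case
      using assms by (intro euler_pow_occ_flip_exp) (auto simp: mult_ac)
  qed
qed (use assms in auto)

section \<open>Translation covariance\<close>

lemma euler_shift: "euler a b h f (shift \<eta>) = euler (a + 1) (b + 1) h (\<lambda>\<eta>. f (shift \<eta>)) \<eta>"
proof -
  have "bond x f (shift \<eta>) = bond (x + 1) (\<lambda>\<eta>. f (shift \<eta>)) \<eta>" for x
  proof -
    have "exchange x (x + 1) (shift \<eta>) = shift (exchange (x + 1) (x + 1 + 1) \<eta>)"
      by (auto simp: shift_def exchange_def fun_eq_iff)
    moreover have "rate x (shift \<eta>) = rate (x + 1) \<eta>" by (simp add: rate_def shift_def)
    ultimately show ?thesis by (simp add: bond_def)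
  qed
  then have "box_gen a b f (shift \<eta>) = (\<Sum>x\<in>{a..<b}. bond (x + 1) (\<lambda>\<eta>. f (shift \<eta>)) \<eta>)"
    by (simp add: box_gen_def)
  also have "\<dots> = box_gen (a + 1) (b + 1) (\<lambda>\<eta>. f (shift \<eta>)) \<eta>"
    unfolding box_gen_def by (rule sum.reindex_bij_witness[of _ "\<lambda>x. x - 1" "\<lambda>x. x + 1"]) auto
  finally show ?thesis by (simp add: euler_def)
qed

lemma euler_pow_shift:
  "(euler a b h ^^ n) f (shift \<eta>) = (euler (a + 1) (b + 1) h ^^ n) (\<lambda>\<eta>. f (shift \<eta>)) \<eta>"
  by (induction n arbitrary: \<eta>) (simp_all add: euler_shift)

text \<open>The schemes in translated boxes are translates of each other, and their limit identifies
  \<open>P t\<close> on \<open>occ x\<close>.\<close>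

lemma P_occ_shift:
  assumes "0 \<le> t"
  shows "P t (obs (occ x)) (shift \<eta>) = P t (obs (occ (x + 1))) \<eta>"
proof (rule LIMSEQ_unique[OF euler_tendsto[OF assms]])
  have "(\<lambda>\<eta>. occ x (shift \<eta>)) = occ (x + 1)" by (simp add: occ_def shift_def fun_eq_iff)
  then show "(\<lambda>k. (euler (x - int k) (x + int k) (t / real (k ^ 4)) ^^ (k ^ 4)) (occ x) (shift \<eta>))
    \<longlonglongrightarrow> P t (obs (occ (x + 1))) \<eta>"
    using euler_tendsto[OF assms, of "x + 1" \<eta>] by (simp add: euler_pow_shift algebra_simps)
qed

end

section \<open>Bernoulli product measures\<close>

lemma sum_telescope_int:
  fixes Z :: "int \<Rightarrow> real"
  shows "(\<Sum>x\<in>{m..<m + int k}. Z (x + 1) - Z x) = Z (m + int k) - Z m"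
proof (induction k)
  case (Suc k)
  have "{m..<m + int (Suc k)} = insert (m + int k) {m..<m + int k}" by auto
  then show ?case using Suc by (simp add: ac_simps)
qed simp

text \<open>Bounded Borel functions. The class is stable under the operations used below, so
  integrability is settled syntactically by \<open>nice_intros\<close>.\<close>

definition nice :: "(config \<Rightarrow> real) \<Rightarrow> bool" where
  "nice f \<longleftrightarrow> f \<in> borel_measurable borel \<and> (\<exists>c. \<forall>\<eta>. \<bar>f \<eta>\<bar> \<le> c)"

lemma nice_bcontfun: "nice (apply_bcontfun F)"
  unfolding nice_def
proof
  show "apply_bcontfun F \<in> borel_measurable borel"
    by (intro borel_measurable_continuous_onI continuous_on_apply_bcontfun)
  show "\<exists>c. \<forall>\<eta>. \<bar>F \<eta>\<bar> \<le> c"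
    using norm_bounded[of F] by auto
qed

lemma nice_depends_on: "depends_on f A \<Longrightarrow> finite A \<Longrightarrow> nice f"
  using nice_bcontfun[of "obs f"] by (simp add: apply_obs)

lemma nice_occ: "nice (occ x)"
  by (rule nice_depends_on[of _ "{x}"]) (auto intro: depends_on_occ)

lemma nice_const: "nice (\<lambda>_. c)"
  unfolding nice_def by auto

lemma nice_add:
  assumes "nice f" "nice g"
  shows "nice (\<lambda>\<eta>. f \<eta> + g \<eta>)"
proof -
  obtain c d where "\<And>\<eta>. \<bar>f \<eta>\<bar> \<le> c" "\<And>\<eta>. \<bar>g \<eta>\<bar> \<le> d"
    using assms unfolding nice_def by auto
  then have "\<bar>f \<eta> + g \<eta>\<bar> \<le> c + d" for \<eta>
    by (intro order_trans[OF abs_triangle_ineq] add_mono)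
  moreover have "(\<lambda>\<eta>. f \<eta> + g \<eta>) \<in> borel_measurable borel"
    using assms unfolding nice_def by (intro borel_measurable_add) auto
  ultimately show ?thesis unfolding nice_def by blast
qed

lemma nice_mult:
  assumes "nice f" "nice g"
  shows "nice (\<lambda>\<eta>. f \<eta> * g \<eta>)"
proof -
  obtain c d where c: "\<And>\<eta>. \<bar>f \<eta>\<bar> \<le> c" and d: "\<And>\<eta>. \<bar>g \<eta>\<bar> \<le> d"
    using assms unfolding nice_def by auto
  have "0 \<le> c" using c[of undefined] by linarith
  then have "\<bar>f \<eta> * g \<eta>\<bar> \<le> c * d" for \<eta>
    unfolding abs_mult by (intro mult_mono c d) auto
  moreover have "(\<lambda>\<eta>. f \<eta> * g \<eta>) \<in> borel_measurable borel"
    using assms unfolding nice_def by (intro borel_measurable_times) auto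
  ultimately show ?thesis unfolding nice_def by blast
qed

lemma nice_diff: "nice f \<Longrightarrow> nice g \<Longrightarrow> nice (\<lambda>\<eta>. f \<eta> - g \<eta>)"
  using nice_add[of f "\<lambda>\<eta>. (- 1) * g \<eta>"] nice_mult[OF nice_const[of "- 1"], of g] by simp

lemma nice_sum: "(\<And>i. i \<in> I \<Longrightarrow> nice (f i)) \<Longrightarrow> nice (\<lambda>\<eta>. \<Sum>i\<in>I. f i \<eta>)"
  by (induction I rule: infinite_finite_induct) (auto intro: nice_add nice_const)

lemma nice_compose:
  assumes "nice f" "continuous_on UNIV \<phi>"
  shows "nice (\<lambda>\<eta>. f (\<phi> \<eta> :: config))"
proof -
  have "\<phi> \<in> borel_measurable borel" using assms(2) by (rule borel_measurable_continuous_onI)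
  then have "(\<lambda>\<eta>. f (\<phi> \<eta>)) \<in> borel_measurable borel"
    using assms(1) unfolding nice_def by (auto intro: measurable_compose)
  then show ?thesis using assms(1) unfolding nice_def by blast
qed

lemma continuous_upd: "continuous_on UNIV (\<lambda>\<eta> :: config. \<eta>(y := v))"
proof (rule continuous_on_coordinatewise_then_product)
  fix x show "continuous_on UNIV (\<lambda>\<eta> :: config. (\<eta>(y := v)) x)"
    by (cases "x = y") (auto intro: continuous_on_product_coordinates)
qed

lemma continuous_exchange: "continuous_on UNIV (exchange y z)"
proof (rule continuous_on_coordinatewise_then_product)
  fix x show "continuous_on UNIV (\<lambda>\<eta>. exchange y z \<eta> x)"
    by (cases "x = z"; cases "x = y") (auto simp: exchange_def intro: continuous_on_product_coordinates)
qed

lemma nice_upd: "nice f \<Longrightarrow> nice (\<lambda>\<eta>. f (\<eta>(y := v)))"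
  by (rule nice_compose[OF _ continuous_upd])

lemma nice_exchange: "nice f \<Longrightarrow> nice (\<lambda>\<eta>. f (exchange y z \<eta>))"
  by (rule nice_compose[OF _ continuous_exchange])

lemma (in nn_rates) nice_rate: "nice (rate x)"
  by (rule nice_depends_on[of _ "{x, x + 1}"]) (auto simp: depends_on_def rate_def)

lemmas nice_intros = nice_add nice_mult nice_diff nice_sum nice_const nice_occ nice_upd nice_exchange
  nice_bcontfun

locale bernoulli =
  fixes \<rho> :: real
  assumes \<rho>: "0 < \<rho>" "\<rho> < 1"
begin

definition \<pi> :: "config measure" where "\<pi> = bernoulli_product \<rho>"

definition cen :: "int \<Rightarrow> config \<Rightarrow> real" where
  "cen x \<eta> = occ x \<eta> - \<rho>"

lemma nice_cen: "nice (cen x)"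
  unfolding cen_def by (intro nice_intros)

lemma cen_upd: "cen x (\<eta>(y := v)) = (if x = y then of_bool v - \<rho> else cen x \<eta>)"
  by (simp add: cen_def occ_def)

lemma cen_bound: "\<bar>cen x \<eta>\<bar> \<le> 1"
  using \<rho> by (auto simp: cen_def occ_def)

lemma sets_\<pi> [measurable_cong]: "sets \<pi> = sets borel"
  unfolding \<pi>_def by (rule sets_bernoulli_product)

sublocale prob_space \<pi>
  unfolding \<pi>_def bernoulli_product_def
  by (intro prob_space_PiM measure_pmf.prob_space_axioms)

lemma nice_measurable: "nice f \<Longrightarrow> f \<in> borel_measurable \<pi>"
  using measurable_cong_sets[OF sets_\<pi> refl] unfolding nice_def by auto

lemma nice_integrable:
  assumes "nice f"
  shows "integrable \<pi> f"
proof -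
  obtain c where "\<And>\<eta>. \<bar>f \<eta>\<bar> \<le> c" using assms unfolding nice_def by auto
  then show ?thesis
    using nice_measurable[OF assms] by (intro integrable_const_bound[of _ c]) auto
qed

text \<open>Redrawing the coordinate \<open>y\<close> independently preserves a product measure;
  splitting by the new value gives the two terms.\<close>

lemma resample:
  assumes "nice f"
  shows "(\<integral>\<eta>. f \<eta> \<partial>\<pi>) = \<rho> * (\<integral>\<eta>. f (\<eta>(y := True)) \<partial>\<pi>) + (1 - \<rho>) * (\<integral>\<eta>. f (\<eta>(y := False)) \<partial>\<pi>)"
proof -
  let ?B = "measure_pmf (bernoulli_pmf \<rho>)"
  interpret B: prob_space ?B by (rule measure_pmf.prob_space_axioms)
  interpret pair_sigma_finite ?B \<pi> ..
  interpret BP: pair_prob_space ?B \<pi> ..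
  have \<pi>: "\<pi> = (\<Pi>\<^sub>M x\<in>UNIV. ?B)" by (simp add: \<pi>_def bernoulli_product_def)
  have D: "distr (?B \<Otimes>\<^sub>M \<pi>) \<pi> (\<lambda>(x, X). X(y := x)) = \<pi>"
    using distr_pair_PiM_eq_PiM[of UNIV "\<lambda>_. ?B" y]
    unfolding \<pi> by (simp add: measure_pmf.prob_space_axioms)
  have M: "(\<lambda>(x, X). X(y := x)) \<in> ?B \<Otimes>\<^sub>M \<pi> \<rightarrow>\<^sub>M \<pi>"
    unfolding \<pi> case_prod_beta by (rule measurable_fun_upd[where J = UNIV]) auto
  have fm: "f \<in> borel_measurable \<pi>" by (rule nice_measurable[OF assms])
  obtain c where c: "\<And>\<eta>. \<bar>f \<eta>\<bar> \<le> c" using assms unfolding nice_def by auto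
  have int: "integrable (?B \<Otimes>\<^sub>M \<pi>) (\<lambda>(x, X). f (X(y := x)))"
    using measurable_compose[OF M fm] c
    by (intro BP.integrable_const_bound[of _ c]) (auto simp: case_prod_beta)
  have "(\<integral>\<eta>. f \<eta> \<partial>\<pi>) = (\<integral>\<eta>. f \<eta> \<partial>distr (?B \<Otimes>\<^sub>M \<pi>) \<pi> (\<lambda>(x, X). X(y := x)))"
    by (simp add: D)
  also have "\<dots> = (\<integral>z. f ((\<lambda>(x, X). X(y := x)) z) \<partial>(?B \<Otimes>\<^sub>M \<pi>))"
    by (rule integral_distr[OF M fm])
  also have "\<dots> = (\<integral>(x, X). f (X(y := x)) \<partial>(?B \<Otimes>\<^sub>M \<pi>))"
    by (intro Bochner_Integration.integral_cong) auto
  also have "\<dots> = (\<integral>x. (\<integral>X. f (X(y := x)) \<partial>\<pi>) \<partial>?B)"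
    using integral_fst'[OF int] by (simp add: case_prod_beta)
  also have "\<dots> = \<rho> * (\<integral>\<eta>. f (\<eta>(y := True)) \<partial>\<pi>) + (1 - \<rho>) * (\<integral>\<eta>. f (\<eta>(y := False)) \<partial>\<pi>)"
    using \<rho> by simp
  finally show ?thesis .
qed

lemma integral_shift:
  assumes "nice f"
  shows "(\<integral>\<eta>. f (shift \<eta>) \<partial>\<pi>) = (\<integral>\<eta>. f \<eta> \<partial>\<pi>)"
proof -
  let ?B = "measure_pmf (bernoulli_pmf \<rho>)"
  have \<pi>: "\<pi> = (\<Pi>\<^sub>M x\<in>UNIV. ?B)" by (simp add: \<pi>_def bernoulli_product_def)
  have D: "distr \<pi> \<pi> shift = \<pi>"
    using distr_PiM_reindex[of UNIV "\<lambda>_. ?B" "\<lambda>x :: int. x + 1" UNIV]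
    unfolding \<pi> shift_def by (simp add: inj_on_def restrict_UNIV measure_pmf.prob_space_axioms)
  have M: "shift \<in> \<pi> \<rightarrow>\<^sub>M \<pi>"
    unfolding \<pi> shift_def by (rule measurable_PiM_single') (auto simp: space_PiM)
  show ?thesis
    using integral_distr[OF M nice_measurable[OF assms]] by (simp add: D)
qed

text \<open>Integration by parts for a Bernoulli variable: \<open>cen y\<close> is
  \<open>1 - \<rho>\<close> with weight \<open>\<rho>\<close> and \<open>- \<rho>\<close> with
  weight \<open>1 - \<rho>\<close>, so both terms carry the same factor up to sign.\<close>

lemma integral_cen_mult:
  assumes "nice f"
  shows "(\<integral>\<eta>. cen y \<eta> * f \<eta> \<partial>\<pi>) = \<rho> * (1 - \<rho>) * (\<integral>\<eta>. f (\<eta>(y := True)) - f (\<eta>(y := False)) \<partial>\<pi>)"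
proof -
  have "(\<integral>\<eta>. cen y \<eta> * f \<eta> \<partial>\<pi>)
    = \<rho> * ((1 - \<rho>) * (\<integral>\<eta>. f (\<eta>(y := True)) \<partial>\<pi>)) + (1 - \<rho>) * (- \<rho> * (\<integral>\<eta>. f (\<eta>(y := False)) \<partial>\<pi>))"
    using resample[OF nice_mult[OF nice_cen assms], of y y] by (simp add: cen_upd)
  then show ?thesis
    using nice_integrable[OF nice_upd[OF assms]] by (simp add: algebra_simps)
qed

text \<open>Turns a bound on the influence of \<open>y\<close> into a bound on correlations;
  \<open>g\<close> ignores \<open>y\<close> and factors out of the difference.\<close>

lemma integral_cen_bound:
  assumes f: "nice f" and g: "nice g" "\<And>\<eta>. \<bar>g \<eta>\<bar> \<le> 1" "\<And>\<eta> v. g (\<eta>(y := v)) = g \<eta>"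
    and d: "\<And>\<eta>. \<bar>f (\<eta>(y := True)) - f (\<eta>(y := False))\<bar> \<le> d"
  shows "\<bar>\<integral>\<eta>. cen y \<eta> * g \<eta> * f \<eta> \<partial>\<pi>\<bar> \<le> d"
proof -
  let ?D = "\<lambda>\<eta>. g \<eta> * (f (\<eta>(y := True)) - f (\<eta>(y := False)))"
  have d0: "0 \<le> d" using d[of undefined] by linarith
  have eq: "(\<integral>\<eta>. cen y \<eta> * g \<eta> * f \<eta> \<partial>\<pi>) = \<rho> * (1 - \<rho>) * (\<integral>\<eta>. ?D \<eta> \<partial>\<pi>)"
    using integral_cen_mult[OF nice_mult[OF g(1) f], of y] by (simp add: g(3) algebra_simps)
  have "\<bar>\<integral>\<eta>. ?D \<eta> \<partial>\<pi>\<bar> \<le> (\<integral>\<eta>. \<bar>?D \<eta>\<bar> \<partial>\<pi>)" by (rule integral_abs_bound)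
  also have "\<dots> \<le> (\<integral>\<eta>. d \<partial>\<pi>)"
  proof (rule integral_mono)
    show "integrable \<pi> (\<lambda>\<eta>. \<bar>?D \<eta>\<bar>)"
      by (intro integrable_abs nice_integrable nice_intros f g(1))
    fix \<eta>
    have "\<bar>?D \<eta>\<bar> \<le> 1 * d" unfolding abs_mult by (intro mult_mono g d) auto
    then show "\<bar>?D \<eta>\<bar> \<le> d" by simp
  qed simp
  finally have "\<bar>\<integral>\<eta>. ?D \<eta> \<partial>\<pi>\<bar> \<le> d" by (simp add: prob_space)
  moreover have "\<rho> * (1 - \<rho>) \<le> 1 * 1" using \<rho> by (intro mult_mono) auto
  ultimately have "\<rho> * (1 - \<rho>) * \<bar>\<integral>\<eta>. ?D \<eta> \<partial>\<pi>\<bar> \<le> 1 * d"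
    using \<rho> by (intro mult_mono) auto
  then show ?thesis unfolding eq using \<rho> by (simp add: abs_mult)
qed

text \<open>Integration by parts at both sites produces the mixed second difference, which is minus
  \<open>quad 1 1\<close>.\<close>

lemma integral_cen_cen:
  assumes f: "nice f"
  shows "(\<integral>\<eta>. cen 0 \<eta> * cen 1 \<eta> * f \<eta> \<partial>\<pi>) = - (\<rho> * (1 - \<rho>))\<^sup>2 * (\<integral>\<eta>. quad 1 1 f \<eta> 0 1 \<partial>\<pi>)"
proof -
  have "(\<integral>\<eta>. cen 0 \<eta> * cen 1 \<eta> * f \<eta> \<partial>\<pi>)
     = \<rho> * (1 - \<rho>) * (\<integral>\<eta>. cen 1 \<eta> * (f (\<eta>(0 := True)) - f (\<eta>(0 := False))) \<partial>\<pi>)"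
    using integral_cen_mult[OF nice_mult[OF nice_cen f], of 0 1]
    by (simp add: cen_upd algebra_simps)
  also have "(\<integral>\<eta>. cen 1 \<eta> * (f (\<eta>(0 := True)) - f (\<eta>(0 := False))) \<partial>\<pi>)
     = \<rho> * (1 - \<rho>) * (\<integral>\<eta>. (f (\<eta>(1 := True, 0 := True)) - f (\<eta>(1 := True, 0 := False)))
          - (f (\<eta>(1 := False, 0 := True)) - f (\<eta>(1 := False, 0 := False))) \<partial>\<pi>)"
    using f by (intro integral_cen_mult nice_intros)
  also have "(\<lambda>\<eta>. (f (\<eta>(1 := True, 0 := True)) - f (\<eta>(1 := True, 0 := False)))
          - (f (\<eta>(1 := False, 0 := True)) - f (\<eta>(1 := False, 0 := False)))) = (\<lambda>\<eta>. - quad 1 1 f \<eta> 0 1)"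
  proof
    fix \<eta> :: config
    have "\<eta>(1 := i, 0 := j) = \<eta>(0 := j, 1 := i)" for i j by (rule fun_upd_twist) simp
    then show "(f (\<eta>(1 := True, 0 := True)) - f (\<eta>(1 := True, 0 := False)))
          - (f (\<eta>(1 := False, 0 := True)) - f (\<eta>(1 := False, 0 := False))) = - quad 1 1 f \<eta> 0 1"
      by (simp add: quad_def)
  qed
  finally show ?thesis by (simp add: power2_eq_square)
qed

text \<open>After both sites are redrawn, 10 and 01 carry the same weight
  \<open>\<rho> * (1 - \<rho>)\<close>, and the exchange swaps them.\<close>

lemma integral_exchange:
  assumes f: "nice f" and xy: "x \<noteq> y"
  shows "(\<integral>\<eta>. f (exchange x y \<eta>) \<partial>\<pi>) = (\<integral>\<eta>. f \<eta> \<partial>\<pi>)"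
proof -
  let ?E = "\<lambda>g i j. \<integral>\<eta>. g (\<eta>(x := i, y := j)) \<partial>\<pi>"
  have two: "(\<integral>\<eta>. g \<eta> \<partial>\<pi>) = \<rho> * (\<rho> * ?E g True True + (1 - \<rho>) * ?E g False True)
      + (1 - \<rho>) * (\<rho> * ?E g True False + (1 - \<rho>) * ?E g False False)" if "nice g" for g
    using resample[OF that, of y] resample[OF nice_upd[OF that, of y True], of x]
      resample[OF nice_upd[OF that, of y False], of x] by simp
  have ex: "exchange x y (\<eta>(x := i, y := j)) = \<eta>(x := j, y := i)" for \<eta> i j
    using xy by (auto simp: exchange_def fun_eq_iff)
  show ?thesis
    unfolding two[OF f] two[OF nice_exchange[OF f]] ex by (simp add: algebra_simps)
qed

definition pairing :: "(config \<Rightarrow> real) \<Rightarrow> observable \<Rightarrow> real" where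
  "pairing g F = (\<integral>\<eta>. g \<eta> * F \<eta> \<partial>\<pi>)"

lemma bounded_linear_pairing:
  assumes "nice g"
  shows "bounded_linear (pairing g)"
proof -
  obtain c where c: "\<And>\<eta>. \<bar>g \<eta>\<bar> \<le> c" using assms unfolding nice_def by auto
  have int: "integrable \<pi> (\<lambda>\<eta>. g \<eta> * F \<eta>)" for F :: observable
    by (intro nice_integrable nice_intros assms)
  show ?thesis
  proof (rule bounded_linear_intro)
    fix F G :: observable and r :: real
    show "pairing g (F + G) = pairing g F + pairing g G"
      using int[of F] int[of G] by (simp add: pairing_def distrib_left)
    show "pairing g (r *\<^sub>R F) = r *\<^sub>R pairing g F"
      by (simp add: pairing_def mult.left_commute)
    have "\<bar>pairing g F\<bar> \<le> (\<integral>\<eta>. \<bar>g \<eta> * F \<eta>\<bar> \<partial>\<pi>)"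
      unfolding pairing_def by (rule integral_abs_bound)
    also have "\<dots> \<le> (\<integral>\<eta>. c * norm F \<partial>\<pi>)"
    proof (rule integral_mono)
      show "integrable \<pi> (\<lambda>\<eta>. \<bar>g \<eta> * F \<eta>\<bar>)" using int by (rule integrable_abs)
      fix \<eta> show "\<bar>g \<eta> * F \<eta>\<bar> \<le> c * norm F"
        unfolding abs_mult using c[of \<eta>] norm_bounded[of F \<eta>] by (intro mult_mono) auto
    qed simp
    finally show "norm (pairing g F) \<le> norm F * c" by (simp add: prob_space mult.commute)
  qed
qed

lemma pairing_error:
  fixes F :: observable
  assumes "nice g" "\<And>\<eta>. \<bar>g \<eta>\<bar> \<le> 1" "nice f" "\<And>\<eta>. \<bar>F \<eta> - f \<eta>\<bar> \<le> e"
  shows "\<bar>pairing g F - (\<integral>\<eta>. g \<eta> * f \<eta> \<partial>\<pi>)\<bar> \<le> e"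
proof -
  have "pairing g F - (\<integral>\<eta>. g \<eta> * f \<eta> \<partial>\<pi>) = (\<integral>\<eta>. g \<eta> * (F \<eta> - f \<eta>) \<partial>\<pi>)"
    unfolding pairing_def right_diff_distrib
    by (intro Bochner_Integration.integral_diff[symmetric] nice_integrable nice_intros assms)
  also have "\<bar>\<dots>\<bar> \<le> (\<integral>\<eta>. \<bar>g \<eta> * (F \<eta> - f \<eta>)\<bar> \<partial>\<pi>)" by (rule integral_abs_bound)
  also have "\<dots> \<le> (\<integral>\<eta>. e \<partial>\<pi>)"
  proof (rule integral_mono)
    show "integrable \<pi> (\<lambda>\<eta>. \<bar>g \<eta> * (F \<eta> - f \<eta>)\<bar>)"
      by (intro integrable_abs nice_integrable nice_intros assms)
    fix \<eta>
    have "\<bar>g \<eta> * (F \<eta> - f \<eta>)\<bar> \<le> 1 * e" unfolding abs_mult by (intro mult_mono assms) auto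
    then show "\<bar>g \<eta> * (F \<eta> - f \<eta>)\<bar> \<le> e" by simp
  qed simp
  finally show ?thesis by (simp add: prob_space)
qed

end

section \<open>Adjoint of the generator in equilibrium\<close>

locale stationary_semigroup = nn_semigroup + bernoulli
begin

text \<open>Up to a constant, the current of the reversed process through the bond \<open>{x, x + 1}\<close>.\<close>

definition cur :: "int \<Rightarrow> config \<Rightarrow> real" where
  "cur x \<eta> = (q + (p - q) * \<rho>) * cen x \<eta> - (p - (p - q) * \<rho>) * cen (x + 1) \<eta>
     + (p - q) * (cen x \<eta> * cen (x + 1) \<eta>)"

lemma nice_cur: "nice (cur x)"
  unfolding cur_def by (intro nice_intros nice_cen)

lemma nice_bond: "nice f \<Longrightarrow> nice (bond x f)"
  unfolding bond_def by (intro nice_intros nice_rate)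

text \<open>
  Summation by parts in equilibrium; reversing a bond swaps \<open>p\<close> and \<open>q\<close>,
  which leaves a telescoping boundary term.
\<close>

lemma integral_cen_box_gen:
  assumes f: "depends_on f {a..b}" and ab: "a \<le> - 1" "1 \<le> b"
  shows "(\<integral>\<eta>. cen 0 \<eta> * box_gen (a - 1) (b + 1) f \<eta> \<partial>\<pi>) = (\<integral>\<eta>. (cur (- 1) \<eta> - cur 0 \<eta>) * f \<eta> \<partial>\<pi>)"
proof -
  \<comment> \<open>\<open>R\<close> is the rate of the time-reversed bond, with \<open>p\<close>
    and \<open>q\<close> swapped, and \<open>V\<close> is the action of that bond on
    \<open>cen 0\<close>.\<close>
  define R where "R x \<eta> = rate x (exchange x (x + 1) \<eta>)" for x \<eta>
  define V where "V x \<eta> = R x \<eta> * (cen 0 (exchange x (x + 1) \<eta>) - cen 0 \<eta>)" for x \<eta>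
  let ?I = "{a - 1..<b + 1}"
  have nf: "nice f" using f by (rule nice_depends_on) simp
  have nR: "nice (R x)" for x unfolding R_def by (intro nice_intros nice_rate)
  have nV: "nice (V x)" for x unfolding V_def by (intro nice_intros nR nice_cen)
  have bond_int: "(\<integral>\<eta>. cen 0 \<eta> * bond x f \<eta> \<partial>\<pi>)
      = (\<integral>\<eta>. V x \<eta> * f \<eta> \<partial>\<pi>) - (p - q) * (\<integral>\<eta>. (cen x \<eta> - cen (x + 1) \<eta>) * (cen 0 \<eta> * f \<eta>) \<partial>\<pi>)" for x
  proof -
    let ?g = "\<lambda>\<eta>. cen 0 (exchange x (x + 1) \<eta>) * R x \<eta> * f \<eta>"
    have "(\<integral>\<eta>. cen 0 \<eta> * bond x f \<eta> \<partial>\<pi>)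
      = (\<integral>\<eta>. cen 0 \<eta> * rate x \<eta> * f (exchange x (x + 1) \<eta>) - cen 0 \<eta> * rate x \<eta> * f \<eta> \<partial>\<pi>)"
      by (simp add: bond_def algebra_simps)
    also have "\<dots> = (\<integral>\<eta>. cen 0 \<eta> * rate x \<eta> * f (exchange x (x + 1) \<eta>) \<partial>\<pi>)
        - (\<integral>\<eta>. cen 0 \<eta> * rate x \<eta> * f \<eta> \<partial>\<pi>)"
      by (intro Bochner_Integration.integral_diff nice_integrable nice_intros nice_cen nice_rate nf)
    also have "(\<integral>\<eta>. cen 0 \<eta> * rate x \<eta> * f (exchange x (x + 1) \<eta>) \<partial>\<pi>) = (\<integral>\<eta>. ?g \<eta> \<partial>\<pi>)"
    proof -
      have "exchange x (x + 1) (exchange x (x + 1) \<eta>) = \<eta>" for \<eta>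
        by (auto simp: exchange_def fun_eq_iff)
      then have "(\<integral>\<eta>. cen 0 \<eta> * rate x \<eta> * f (exchange x (x + 1) \<eta>) \<partial>\<pi>) = (\<integral>\<eta>. ?g (exchange x (x + 1) \<eta>) \<partial>\<pi>)"
        by (simp add: R_def)
      also have "\<dots> = (\<integral>\<eta>. ?g \<eta> \<partial>\<pi>)"
        by (intro integral_exchange nice_intros nice_cen nR nf) simp
      finally show ?thesis .
    qed
    also have "(\<integral>\<eta>. ?g \<eta> \<partial>\<pi>) - (\<integral>\<eta>. cen 0 \<eta> * rate x \<eta> * f \<eta> \<partial>\<pi>)
        = (\<integral>\<eta>. ?g \<eta> - cen 0 \<eta> * rate x \<eta> * f \<eta> \<partial>\<pi>)"
      by (intro Bochner_Integration.integral_diff[symmetric] nice_integrable nice_intros nice_cen nice_rate nR nf)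
    also have "\<dots> = (\<integral>\<eta>. V x \<eta> * f \<eta> - (p - q) * ((cen x \<eta> - cen (x + 1) \<eta>) * (cen 0 \<eta> * f \<eta>)) \<partial>\<pi>)"
    proof (rule Bochner_Integration.integral_cong[OF refl])
      fix \<eta>
      \<comment> \<open>Swapping \<open>p\<close> and \<open>q\<close> changes the rate by a
        multiple of a difference of neighbouring occupations; this is why the sum over bonds
        telescopes.\<close>
      have R: "R x \<eta> - rate x \<eta> = - ((p - q) * (cen x \<eta> - cen (x + 1) \<eta>))"
        by (auto simp: R_def rate_def exchange_def cen_def occ_def)
      have "?g \<eta> - cen 0 \<eta> * rate x \<eta> * f \<eta>
          = V x \<eta> * f \<eta> + (R x \<eta> - rate x \<eta>) * (cen 0 \<eta> * f \<eta>)"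
        by (simp add: V_def algebra_simps)
      then show "?g \<eta> - cen 0 \<eta> * rate x \<eta> * f \<eta>
          = V x \<eta> * f \<eta> - (p - q) * ((cen x \<eta> - cen (x + 1) \<eta>) * (cen 0 \<eta> * f \<eta>))"
        unfolding R by (simp add: mult.assoc)
    qed
    also have "\<dots> = (\<integral>\<eta>. V x \<eta> * f \<eta> \<partial>\<pi>) - (\<integral>\<eta>. (p - q) * ((cen x \<eta> - cen (x + 1) \<eta>) * (cen 0 \<eta> * f \<eta>)) \<partial>\<pi>)"
      by (intro Bochner_Integration.integral_diff nice_integrable nice_intros nV nice_cen nf)
    finally show ?thesis by simp
  qed
  \<comment> \<open>A site outside the box is independent of \<open>cen 0\<close> and
    \<open>f\<close>, and \<open>cen x\<close> has mean zero.\<close>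
  have boundary: "(\<integral>\<eta>. cen x \<eta> * (cen 0 \<eta> * f \<eta>) \<partial>\<pi>) = 0" if "x \<notin> {a..b}" for x
  proof -
    have "f (\<eta>(x := v)) = f \<eta>" for \<eta> v
      using that by (intro depends_onD[OF f]) auto
    moreover have "x \<noteq> 0" using that ab by auto
    ultimately show ?thesis
      using integral_cen_mult[OF nice_mult[OF nice_cen nf], of x 0] by (simp add: cen_upd)
  qed
  have tele: "(\<Sum>x\<in>?I. cen x \<eta> - cen (x + 1) \<eta>) = cen (a - 1) \<eta> - cen (b + 1) \<eta>" for \<eta>
  proof -
    have e: "a - 1 + int (nat (b + 2 - a)) = b + 1" using ab by simp
    have "(\<Sum>x\<in>?I. - cen (x + 1) \<eta> - - cen x \<eta>) = - cen (b + 1) \<eta> - - cen (a - 1) \<eta>"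
      using sum_telescope_int[of "\<lambda>x. - cen x \<eta>" "a - 1" "nat (b + 2 - a)", unfolded e] .
    then show ?thesis by simp
  qed
  have V: "(\<Sum>x\<in>?I. V x \<eta>) = cur (- 1) \<eta> - cur 0 \<eta>" for \<eta>
  proof -
    \<comment> \<open>Only the two bonds at the origin change \<open>cen 0\<close>.\<close>
    have "(\<Sum>x\<in>?I. V x \<eta>) = (\<Sum>x\<in>{- 1, 0}. V x \<eta>)"
      using ab by (intro sum.mono_neutral_right) (auto simp: V_def cen_def occ_def exchange_def)
    also have "\<dots> = cur (- 1) \<eta> - cur 0 \<eta>"
      by (cases "\<eta> (- 1)"; cases "\<eta> 0"; cases "\<eta> 1")
        (simp_all add: V_def R_def rate_def exchange_def cen_def occ_def cur_def algebra_simps)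
    finally show ?thesis .
  qed
  have "(\<integral>\<eta>. cen 0 \<eta> * box_gen (a - 1) (b + 1) f \<eta> \<partial>\<pi>) = (\<Sum>x\<in>?I. \<integral>\<eta>. cen 0 \<eta> * bond x f \<eta> \<partial>\<pi>)"
    unfolding box_gen_def sum_distrib_left
    by (intro Bochner_Integration.integral_sum nice_integrable nice_intros nice_cen nice_bond nf)
  also have "\<dots> = (\<Sum>x\<in>?I. \<integral>\<eta>. V x \<eta> * f \<eta> \<partial>\<pi>)
      - (p - q) * (\<Sum>x\<in>?I. \<integral>\<eta>. (cen x \<eta> - cen (x + 1) \<eta>) * (cen 0 \<eta> * f \<eta>) \<partial>\<pi>)"
    unfolding bond_int by (simp only: sum_subtractf sum_distrib_left)
  also have "(\<Sum>x\<in>?I. \<integral>\<eta>. V x \<eta> * f \<eta> \<partial>\<pi>) = (\<integral>\<eta>. (\<Sum>x\<in>?I. V x \<eta>) * f \<eta> \<partial>\<pi>)"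
    unfolding sum_distrib_right
    by (intro Bochner_Integration.integral_sum[symmetric] nice_integrable nice_intros nV nf)
  also have "(\<Sum>x\<in>?I. \<integral>\<eta>. (cen x \<eta> - cen (x + 1) \<eta>) * (cen 0 \<eta> * f \<eta>) \<partial>\<pi>)
      = (\<integral>\<eta>. (\<Sum>x\<in>?I. cen x \<eta> - cen (x + 1) \<eta>) * (cen 0 \<eta> * f \<eta>) \<partial>\<pi>)"
    unfolding sum_distrib_right
    by (intro Bochner_Integration.integral_sum[symmetric] nice_integrable nice_intros nice_cen nf)
  also have "\<dots> = (\<integral>\<eta>. cen (a - 1) \<eta> * (cen 0 \<eta> * f \<eta>) \<partial>\<pi>) - (\<integral>\<eta>. cen (b + 1) \<eta> * (cen 0 \<eta> * f \<eta>) \<partial>\<pi>)"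
    unfolding tele left_diff_distrib
    by (intro Bochner_Integration.integral_diff nice_integrable nice_intros nice_cen nf)
  also have "\<dots> = 0" using boundary by simp
  finally show ?thesis by (simp add: V)
qed

text \<open>\<open>P t\<close> leads out of the cylinder functions, so the adjoint identity is
  needed on the whole generator: both sides are continuous in the pair, hence it extends from the
  pregenerator to its closure.\<close>

lemma pairing_generator:
  assumes "(F, G) \<in> generator P"
  shows "pairing (cen 0) G = pairing (\<lambda>\<eta>. cur (- 1) \<eta> - cur 0 \<eta>) F"
proof -
  let ?S = "{z. pairing (cen 0) (snd z) = pairing (\<lambda>\<eta>. cur (- 1) \<eta> - cur 0 \<eta>) (fst z)}"
  have "closed ?S"
    by (intro closed_Collect_eq bounded_linear.continuous_on[OF bounded_linear_pairing]
        continuous_on_fst continuous_on_snd continuous_on_id nice_cen nice_diff nice_cur)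
  moreover have "exclusion_pregenerator jl \<subseteq> ?S"
  proof
    fix z assume "z \<in> exclusion_pregenerator jl"
    then obtain F G where z: "z = (F, G)" and "cylinder (apply_bcontfun F)"
      and G: "apply_bcontfun G = exclusion_operator jl (apply_bcontfun F)"
      by (auto simp: exclusion_pregenerator_def)
    then obtain A where A: "finite A" "depends_on F A"
      unfolding cylinder_def depends_on_def by blast
    \<comment> \<open>Inserting \<open>- 1\<close>, and \<open>1\<close> for \<open>b\<close>, makes
      the box contain both neighbours of the origin.\<close>
    define a where "a = Min (insert (- 1) A)"
    define b where "b = Max (insert 1 A)"
    have ab: "a \<le> - 1" "1 \<le> b" "A \<subseteq> {a..b}"
      using A(1) by (auto simp: a_def b_def)
    have dep: "depends_on F {a..b}" using A(2) ab(3) by (rule depends_on_mono)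
    show "z \<in> ?S"
      using integral_cen_box_gen[OF dep ab(1,2)]
      by (simp add: z pairing_def G exclusion_operator_eq[OF dep])
  qed
  ultimately have "closure (exclusion_pregenerator jl) \<subseteq> ?S"
    by (intro closure_minimal)
  then show ?thesis
    using assms semigroup unfolding exclusion_semigroup_def by auto
qed

end

section \<open>Second moment of the two-point function\<close>

context nn_semigroup
begin

lemma bounded_linear_P:
  assumes "0 \<le> t"
  shows "bounded_linear (P t)"
  by (rule bounded_linear_intro[where K = 1])
    (use assms P_norm in \<open>auto simp: P_add P_scaleR\<close>)

lemma generator_P:
  assumes fg: "(f, g) \<in> generator P" and t: "0 \<le> t"
  shows "(P t f, P t g) \<in> generator P"
proof -
  have "((\<lambda>h. P t ((P h f - f) /\<^sub>R h)) \<longlongrightarrow> P t g) (at_right 0)"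
    using fg by (intro bounded_linear.tendsto[OF bounded_linear_P[OF t]]) (simp add: generator_def)
  moreover have "\<forall>\<^sub>F h in at_right 0. P t ((P h f - f) /\<^sub>R h) = (P h (P t f) - P t f) /\<^sub>R h"
    using eventually_at_right_less
  proof eventually_elim
    case (elim h)
    have "P h (P t f) = P t (P h f)"
      using P_plus[of h t f] P_plus[of t h f] elim t by (simp add: add.commute)
    then show ?case using t by (simp add: P_scaleR P_diff)
  qed
  ultimately show ?thesis
    by (simp add: generator_def tendsto_cong)
qed

end

context stationary_semigroup
begin

text \<open>This is S(x, t) expressed by the semigroup: \<open>cen 0\<close> has mean zero, so
  \<open>occ x\<close> can stay uncentred.\<close>

definition cor :: "int \<Rightarrow> real \<Rightarrow> real" where
  "cor x t = pairing (cen 0) (P t (obs (occ x)))"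

definition cor2 :: "int \<Rightarrow> real \<Rightarrow> real" where
  "cor2 x t = pairing (\<lambda>\<eta>. cen 0 \<eta> * cen 1 \<eta>) (P t (obs (occ x)))"

definition flux :: "int \<Rightarrow> real \<Rightarrow> real" where
  "flux x t = pairing (cur 0) (P t (obs (occ x)))"

lemma pairing_shift:
  assumes "nice g" "0 \<le> t"
  shows "pairing (\<lambda>\<eta>. g (shift \<eta>)) (P t (obs (occ (x + 1)))) = pairing g (P t (obs (occ x)))"
  unfolding pairing_def
  using integral_shift[of "\<lambda>\<eta>. g \<eta> * P t (obs (occ x)) \<eta>"] assms
  by (simp add: nice_intros P_occ_shift)

lemma flux_eq:
  assumes "0 \<le> t"
  shows "flux x t = (q + (p - q) * \<rho>) * cor x t - (p - (p - q) * \<rho>) * cor (x - 1) t + (p - q) * cor2 x t"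
proof -
  let ?F = "P t (obs (occ x))"
  have int: "integrable \<pi> (\<lambda>\<eta>. g \<eta> * ?F \<eta>)" if "nice g" for g
    using that by (intro nice_integrable nice_intros)
  have "(\<lambda>\<eta>. cen 0 (shift \<eta>)) = cen 1"
    by (simp add: cen_def occ_def shift_def fun_eq_iff)
  then have 1: "pairing (cen 1) ?F = cor (x - 1) t"
    using pairing_shift[OF nice_cen assms, of 0 "x - 1"] by (simp add: cor_def)
  have "flux x t = (\<integral>\<eta>. (q + (p - q) * \<rho>) * (cen 0 \<eta> * ?F \<eta>) - (p - (p - q) * \<rho>) * (cen 1 \<eta> * ?F \<eta>)
      + (p - q) * (cen 0 \<eta> * cen 1 \<eta> * ?F \<eta>) \<partial>\<pi>)"
    unfolding flux_def pairing_def
    by (intro Bochner_Integration.integral_cong refl) (simp add: cur_def algebra_simps)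
  also have "\<dots> = (q + (p - q) * \<rho>) * pairing (cen 0) ?F - (p - (p - q) * \<rho>) * pairing (cen 1) ?F
      + (p - q) * pairing (\<lambda>\<eta>. cen 0 \<eta> * cen 1 \<eta>) ?F"
    unfolding pairing_def
    using int[OF nice_cen, of 0] int[OF nice_cen, of 1] int[OF nice_mult[OF nice_cen nice_cen], of 0 1]
    by simp
  finally show ?thesis unfolding 1 by (simp add: cor_def cor2_def)
qed

text \<open>A continuity equation. The adjoint identity gives the pairing with
  \<open>cur (- 1) - cur 0\<close>, and translation turns \<open>cur (- 1)\<close> against
  \<open>occ x\<close> into \<open>cur 0\<close> against \<open>occ (x + 1)\<close>.\<close>

lemma cor_derivative:
  assumes t: "0 < t"
  shows "((\<lambda>t. cor x t) has_real_derivative (flux (x + 1) t - flux x t)) (at t)"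
proof -
  have "depends_on (occ x) {x..x}" by (simp add: depends_on_occ)
  from cylinder_generator[OF this] obtain G where G: "(obs (occ x), G) \<in> generator P" by blast
  have "((\<lambda>t. P t (obs (occ x))) has_vector_derivative P t G) (at t within {0..})"
    using t by (intro generator_derivative[OF G]) simp
  moreover have "at t within {0..} = at t"
    using t by (intro at_within_interior) simp
  ultimately have "((\<lambda>t. cor x t) has_vector_derivative pairing (cen 0) (P t G)) (at t)"
    unfolding cor_def by (intro bounded_linear.has_vector_derivative[OF bounded_linear_pairing[OF nice_cen]]) simp
  moreover have "pairing (cen 0) (P t G) = flux (x + 1) t - flux x t"
  proof -
    let ?F = "P t (obs (occ x))"
    have "pairing (cen 0) (P t G) = pairing (\<lambda>\<eta>. cur (- 1) \<eta> - cur 0 \<eta>) ?F"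
      using t by (intro pairing_generator generator_P[OF G]) simp
    also have "\<dots> = pairing (cur (- 1)) ?F - flux x t"
      unfolding pairing_def flux_def left_diff_distrib
      by (intro Bochner_Integration.integral_diff nice_integrable nice_intros nice_cur)
    also have "(\<lambda>\<eta>. cur (- 1) (shift \<eta>)) = cur 0"
      by (simp add: cur_def cen_def occ_def shift_def fun_eq_iff)
    then have "pairing (cur (- 1)) ?F = flux (x + 1) t"
      using pairing_shift[OF nice_cur, of t "- 1" x] t by (simp add: flux_def)
    finally show ?thesis .
  qed
  ultimately show ?thesis by (simp add: has_real_derivative_iff_has_vector_derivative)
qed

lemma pairing_occ_bound:
  assumes "0 \<le> t" "t \<le> T" "nice g" "\<And>\<eta>. \<bar>g \<eta>\<bar> \<le> 1" "\<And>\<eta> v. g (\<eta>(0 := v)) = g \<eta>"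
  shows "\<bar>pairing (\<lambda>\<eta>. cen 0 \<eta> * g \<eta>) (P t (obs (occ x)))\<bar> \<le> exp (6 * T) * (1/2) ^ nat \<bar>x\<bar>"
  unfolding pairing_def
proof (rule integral_cen_bound[OF nice_bcontfun assms(3-5)])
  fix \<eta>
  have "exp (6 * t) * (1/2) ^ nat \<bar>x\<bar> \<le> exp (6 * T) * (1/2::real) ^ nat \<bar>x\<bar>"
    using assms by (intro mult_right_mono) auto
  then show "\<bar>P t (obs (occ x)) (\<eta>(0 := True)) - P t (obs (occ x)) (\<eta>(0 := False))\<bar> \<le> exp (6 * T) * (1/2) ^ nat \<bar>x\<bar>"
    by (rule order_trans[rotated]) (use P_occ_flip[OF assms(1), of x \<eta> 0] in simp)
qed

lemma cor_bound:
  assumes "0 \<le> t" "t \<le> T"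
  shows "\<bar>cor x t\<bar> \<le> exp (6 * T) * (1/2) ^ nat \<bar>x\<bar>"
  using pairing_occ_bound[OF assms nice_const[of 1]] by (simp add: cor_def)

lemma cor2_bound:
  assumes "0 \<le> t" "t \<le> T"
  shows "\<bar>cor2 x t\<bar> \<le> exp (6 * T) * (1/2) ^ nat \<bar>x\<bar>"
  using pairing_occ_bound[OF assms nice_cen[of 1] cen_bound] by (simp add: cor2_def cen_upd)

section \<open>Signs of truncated sums of correlations\<close>

text \<open>A box of \<open>4 * N + 1\<close> sites, weights at most \<open>2 * N\<close>, and for
  each site the sum of the approximation error \<open>2 * T * exp (6 * T) * (1/2) ^ N\<close> and
  the decay bound \<open>exp (6 * T) * (1/2) ^ N\<close>.\<close>

definition tail :: "real \<Rightarrow> nat \<Rightarrow> real" where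
  "tail T N = (4 * real N + 1) * (2 * real N) * ((2 * T + 1) * exp (6 * T) * (1/2) ^ N)"

text \<open>Transfers a sign from the scheme to the semigroup. The box is twice as wide as the sum:
  inner sites are at distance at least \<open>N\<close> from its ends, so the scheme is accurate
  there; outer sites are farther than \<open>N\<close> from the origin, so their pairings are tiny.
  The factor \<open>c\<close> carries the sign of the drift, or either sign in turn.\<close>

lemma euler_sum_nonneg_imp:
  assumes t: "0 \<le> t" "t \<le> T" and \<psi>: "nice \<psi>" "\<And>\<eta>. \<bar>\<psi> \<eta>\<bar> \<le> 1" "\<And>\<eta> v. \<psi> (\<eta>(0 := v)) = \<psi> \<eta>"
    and g: "\<And>x. \<bar>x\<bar> \<le> 2 * int N \<Longrightarrow> \<bar>g x\<bar> \<le> 2 * real N" and c: "\<bar>c\<bar> \<le> 1"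
    and nonneg: "\<And>h n. 0 \<le> h \<Longrightarrow> h * real_of_int (2 * int N - (- (2 * int N))) \<le> 1 \<Longrightarrow>
      0 \<le> c * (\<integral>\<eta>. cen 0 \<eta> * \<psi> \<eta> * (euler (- (2 * int N)) (2 * int N) h ^^ n) (moment (- (2 * int N)) (2 * int N) g) \<eta> \<partial>\<pi>)"
  shows "- tail T N \<le> c * (\<Sum>x\<in>{- int N..int N}. g x * pairing (\<lambda>\<eta>. cen 0 \<eta> * \<psi> \<eta>) (P t (obs (occ x))))"
    (is "_ \<le> c * ?S")
proof -
  let ?a = "- (2 * int N)" and ?b = "2 * int N"
  let ?G = "\<lambda>\<eta>. cen 0 \<eta> * \<psi> \<eta>"
  let ?E = "exp (6 * T)" and ?J = "{- int N..int N}"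
  let ?U = "\<lambda>n. euler ?a ?b (t / real n) ^^ n"
  define C where "C = (2 * real N + 1) * (2 * real N) * (4 * t\<^sup>2 * (real_of_int (?b - ?a) + 4)\<^sup>2)"
  have nG: "nice ?G" by (intro nice_intros nice_cen \<psi>)
  have G1: "\<bar>?G \<eta>\<bar> \<le> 1" for \<eta>
    unfolding abs_mult using mult_mono[OF cen_bound \<psi>(2)] by simp
  have key: "- tail T N - C / n \<le> c * ?S" if n: "0 < n" "t / n * real_of_int (?b - ?a) \<le> 1" for n :: nat
  proof -
    let ?i = "\<lambda>x. \<integral>\<eta>. ?G \<eta> * ?U n (occ x) \<eta> \<partial>\<pi>"
    define err where "err = 2 * T * ?E * (1/2) ^ N + 4 * t\<^sup>2 * (real_of_int (?b - ?a) + 4)\<^sup>2 / n"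
    have nU: "nice (?U n (occ x))" if "x \<in> {?a..?b}" for x
      using that by (intro nice_depends_on[of _ "{?a..?b}"] depends_on_euler_pow depends_on_occ) auto
    have A: "\<bar>pairing ?G (P t (obs (occ x))) - ?i x\<bar> \<le> err" if x: "x \<in> ?J" for x
    proof (rule pairing_error[OF nG G1 nU])
      fix \<eta>
      have pw: "(1/2::real) ^ nat (x - ?a) \<le> (1/2) ^ N" "(1/2::real) ^ nat (?b - x) \<le> (1/2) ^ N"
        using x by (auto intro!: power_decreasing)
      have "\<bar>P t (obs (occ x)) \<eta> - ?U n (occ x) \<eta>\<bar>
          \<le> t * exp (6 * t) * ((1/2) ^ nat (x - ?a) + (1/2) ^ nat (?b - x))
            + 4 * t\<^sup>2 * (real_of_int (?b - ?a) + 4)\<^sup>2 / n"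
        using t n x by (intro euler_approximation) auto
      also have "t * exp (6 * t) * ((1/2) ^ nat (x - ?a) + (1/2) ^ nat (?b - x))
          \<le> T * ?E * ((1/2) ^ N + (1/2) ^ N)"
        using t pw by (intro mult_mono add_mono) auto
      finally show "\<bar>P t (obs (occ x)) \<eta> - ?U n (occ x) \<eta>\<bar> \<le> err"
        by (simp add: err_def algebra_simps)
    qed (use x in auto)
    have B: "\<bar>?i x\<bar> \<le> ?E * (1/2) ^ N" if x: "x \<in> {?a..?b} - ?J" for x
    proof (rule integral_cen_bound[OF nU \<psi>])
      show "x \<in> {?a..?b}" using x by simp
      fix \<eta>
      have "\<bar>?U n (occ x) (\<eta>(0 := True)) - ?U n (occ x) (\<eta>(0 := False))\<bar> \<le> exp (6 * t) * (1/2) ^ nat \<bar>0 - x\<bar>"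
        using t n by (intro euler_pow_occ_flip_exp) auto
      also have "\<dots> \<le> ?E * (1/2) ^ N"
        using t x by (intro mult_mono power_decreasing) auto
      finally show "\<bar>?U n (occ x) (\<eta>(0 := True)) - ?U n (occ x) (\<eta>(0 := False))\<bar> \<le> ?E * (1/2) ^ N" .
    qed
    have "(\<integral>\<eta>. ?G \<eta> * ?U n (moment ?a ?b g) \<eta> \<partial>\<pi>) = (\<integral>\<eta>. (\<Sum>x\<in>{?a..?b}. g x * (?G \<eta> * ?U n (occ x) \<eta>)) \<partial>\<pi>)"
      unfolding euler_pow_moment sum_distrib_left by (intro Bochner_Integration.integral_cong sum.cong refl) simp
    also have "\<dots> = (\<Sum>x\<in>{?a..?b}. g x * ?i x)"
      by (subst Bochner_Integration.integral_sum)
        (auto intro!: nice_integrable nice_intros nG nU nice_cen \<psi>)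
    also have "\<dots> = (\<Sum>x\<in>?J. g x * ?i x) + (\<Sum>x\<in>{?a..?b} - ?J. g x * ?i x)"
      by (subst sum.subset_diff[of ?J]) auto
    finally have split: "(\<integral>\<eta>. ?G \<eta> * ?U n (moment ?a ?b g) \<eta> \<partial>\<pi>)
       = (\<Sum>x\<in>?J. g x * ?i x) + (\<Sum>x\<in>{?a..?b} - ?J. g x * ?i x)" .
    have "\<bar>?S - (\<Sum>x\<in>?J. g x * ?i x)\<bar> \<le> (\<Sum>x\<in>?J. 2 * real N * err)"
      unfolding sum_subtractf[symmetric] right_diff_distrib[symmetric]
    proof (rule order_trans[OF sum_abs], rule sum_mono)
      fix x assume x: "x \<in> ?J"
      show "\<bar>g x * (pairing ?G (P t (obs (occ x))) - ?i x)\<bar> \<le> 2 * real N * err"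
        unfolding abs_mult using x by (intro mult_mono g A) auto
    qed
    then have 1: "\<bar>?S - (\<Sum>x\<in>?J. g x * ?i x)\<bar> \<le> (2 * real N + 1) * (2 * real N) * err"
      by (simp add: mult.assoc)
    have "\<bar>\<Sum>x\<in>{?a..?b} - ?J. g x * ?i x\<bar> \<le> (\<Sum>x\<in>{?a..?b} - ?J. 2 * real N * (?E * (1/2) ^ N))"
    proof (rule order_trans[OF sum_abs], rule sum_mono)
      fix x assume x: "x \<in> {?a..?b} - ?J"
      show "\<bar>g x * ?i x\<bar> \<le> 2 * real N * (?E * (1/2) ^ N)"
        unfolding abs_mult using x by (intro mult_mono g B) auto
    qed
    also have "card ({?a..?b} - ?J) \<le> 2 * N"
      by (subst card_Diff_subset) auto
    then have "(\<Sum>x\<in>{?a..?b} - ?J. 2 * real N * (?E * (1/2) ^ N)) \<le> real (2 * N) * (2 * real N * (?E * (1/2) ^ N))"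
      by (simp only: sum_constant) (intro mult_right_mono, auto)
    finally have 2: "\<bar>\<Sum>x\<in>{?a..?b} - ?J. g x * ?i x\<bar> \<le> 2 * real N * (2 * real N) * (?E * (1/2) ^ N)"
      by simp
    let ?A = "\<integral>\<eta>. ?G \<eta> * ?U n (moment ?a ?b g) \<eta> \<partial>\<pi>"
    have D: "\<bar>?S - ?A\<bar> \<le> (2 * real N + 1) * (2 * real N) * err + 2 * real N * (2 * real N) * (?E * (1/2) ^ N)"
      using 1 2 unfolding split by linarith
    have "c * u - \<bar>v - u\<bar> \<le> c * v" for u v :: real
    proof -
      have "\<bar>c * (v - u)\<bar> \<le> 1 * \<bar>v - u\<bar>"
        unfolding abs_mult using c by (intro mult_right_mono) auto
      then show ?thesis by (simp add: algebra_simps abs_le_iff)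
    qed
    then have "c * ?A - \<bar>?S - ?A\<bar> \<le> c * ?S" .
    moreover have "0 \<le> c * ?A" using t n by (intro nonneg) auto
    moreover have "(2 * real N + 1) * (2 * real N) * err + 2 * real N * (2 * real N) * (?E * (1/2) ^ N)
        \<le> tail T N + C / n"
    proof -
      have "tail T N + C / n - ((2 * real N + 1) * (2 * real N) * err + 2 * real N * (2 * real N) * (?E * (1/2) ^ N))
          = (2 * real N) * ((2 * real N) * (2 * T) + (2 * real N + 1)) * (?E * (1/2) ^ N)"
        unfolding tail_def C_def err_def by (simp add: algebra_simps add_divide_distrib)
      moreover have "0 \<le> \<dots>" using t by simp
      ultimately show ?thesis by linarith
    qed
    ultimately show ?thesis using D by linarith
  qed
  \<comment> \<open>With \<open>N\<close> fixed, letting the number of steps grow removes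
    \<open>C / n\<close>.\<close>
  have "(\<lambda>n. - tail T N - C / real n) \<longlonglongrightarrow> - tail T N - 0"
    by (intro tendsto_intros lim_const_over_n)
  moreover have "(\<lambda>n. t / real n * real_of_int (?b - ?a)) \<longlonglongrightarrow> 0 * real_of_int (?b - ?a)"
    by (intro tendsto_intros lim_const_over_n)
  then have "\<forall>\<^sub>F n in sequentially. t / real n * real_of_int (?b - ?a) < 1"
    by (rule order_tendstoD) simp
  then have "\<forall>\<^sub>F n in sequentially. - tail T N - C / real n \<le> c * ?S"
    using eventually_gt_at_top[of "0::nat"] by eventually_elim (rule key, auto)
  ultimately show ?thesis
    using tendsto_upperbound[of _ "- tail T N - 0" sequentially "c * ?S"] by simp
qed

text \<open>The scheme fixes the particle number of the box, so the integral keeps its initial value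
  \<open>\<rho> * (1 - \<rho>)\<close>, of which only the sign is retained.\<close>

lemma sum_cor_lower:
  assumes "0 \<le> t" "t \<le> T" "0 < N"
  shows "- tail T N \<le> (\<Sum>x\<in>{- int N..int N}. cor x t)"
proof -
  let ?a = "- (2 * int N)" and ?b = "2 * int N"
  have "- tail T N \<le> 1 * (\<Sum>x\<in>{- int N..int N}. 1 * pairing (\<lambda>\<eta>. cen 0 \<eta> * 1) (P t (obs (occ x))))"
  proof (rule euler_sum_nonneg_imp[OF assms(1,2) nice_const])
    fix h n
    have nm: "nice (moment ?a ?b (\<lambda>_. 1))"
      unfolding moment_def by (intro nice_intros)
    have "moment ?a ?b (\<lambda>_. 1) (\<eta>(0 := True)) - moment ?a ?b (\<lambda>_. 1) (\<eta>(0 := False)) = 1" for \<eta>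
      using moment_upd[of ?a 0 ?b "\<lambda>_. 1" \<eta> True] by simp
    then have "(\<integral>\<eta>. cen 0 \<eta> * moment ?a ?b (\<lambda>_. 1) \<eta> \<partial>\<pi>) = \<rho> * (1 - \<rho>)"
      using integral_cen_mult[OF nm, of 0] by (simp add: prob_space)
    then show "0 \<le> 1 * (\<integral>\<eta>. cen 0 \<eta> * 1 * (euler ?a ?b h ^^ n) (moment ?a ?b (\<lambda>_. 1)) \<eta> \<partial>\<pi>)"
      using \<rho> by (simp add: euler_pow_moment_const)
  qed (use assms(3) in auto)
  then show ?thesis by (simp add: cor_def)
qed

text \<open>The mixed second difference of the conserved particle number is zero;
  \<open>c = 1\<close> and \<open>c = - 1\<close> together bound the absolute value.\<close>

lemma sum_cor2_bound:
  assumes "0 \<le> t" "t \<le> T" "0 < N"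
  shows "\<bar>\<Sum>x\<in>{- int N..int N}. cor2 x t\<bar> \<le> tail T N"
proof -
  let ?a = "- (2 * int N)" and ?b = "2 * int N"
  have *: "- tail T N \<le> c * (\<Sum>x\<in>{- int N..int N}. 1 * pairing (\<lambda>\<eta>. cen 0 \<eta> * cen 1 \<eta>) (P t (obs (occ x))))"
    if "\<bar>c\<bar> \<le> 1" for c
  proof (rule euler_sum_nonneg_imp[OF assms(1,2) nice_cen cen_bound _ _ that])
    fix h n
    have nm: "nice (moment ?a ?b (\<lambda>_. 1))"
      unfolding moment_def by (intro nice_intros)
    have "quad 1 1 (moment ?a ?b (\<lambda>_. 1)) \<eta> 0 1 = 0" for \<eta>
      using assms(3) by (subst quad_moment) auto
    then have "(\<integral>\<eta>. cen 0 \<eta> * cen 1 \<eta> * moment ?a ?b (\<lambda>_. 1) \<eta> \<partial>\<pi>) = 0"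
      using integral_cen_cen[OF nm] by simp
    then show "0 \<le> c * (\<integral>\<eta>. cen 0 \<eta> * cen 1 \<eta> * (euler ?a ?b h ^^ n) (moment ?a ?b (\<lambda>_. 1)) \<eta> \<partial>\<pi>)"
      by (simp add: euler_pow_moment_const)
  qed (use assms(3) in \<open>auto simp: cen_upd\<close>)
  from *[of 1] *[of "- 1"] show ?thesis by (simp add: cor2_def abs_le_iff)
qed

text \<open>The sign comes from the minimum principle for the weights \<open>g x = x\<close>; the
  leading minus compensates the one in \<open>integral_cen_cen\<close>.\<close>

lemma sum_first_moment_cor2:
  assumes "0 \<le> t" "t \<le> T" "0 < N"
  shows "- tail T N \<le> - (p - q) * (\<Sum>x\<in>{- int N..int N}. real_of_int x * cor2 x t)"
  unfolding cor2_def
proof (rule euler_sum_nonneg_imp[OF assms(1,2) nice_cen cen_bound])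
  let ?a = "- (2 * int N)" and ?b = "2 * int N"
  fix h :: real and n assume h: "0 \<le> h" "h * real_of_int (?b - ?a) \<le> 1"
  let ?u = "(euler ?a ?b h ^^ n) (moment ?a ?b real_of_int)"
  have "depends_on (moment ?a ?b real_of_int) {?a..?b}"
    by (auto simp: depends_on_def moment_def occ_def intro!: sum.cong)
  then have nu: "nice ?u" by (intro nice_depends_on[of _ "{?a..?b}"] depends_on_euler_pow) auto
  have "0 \<le> (\<integral>\<eta>. (p - q) * quad 1 1 ?u \<eta> 0 1 \<partial>\<pi>)"
    using quad_euler_pow_moment[OF h, of real_of_int 0 1 n] assms(3)
    by (intro integral_nonneg_AE) (auto simp: mono_def)
  then have "0 \<le> (\<rho> * (1 - \<rho>))\<^sup>2 * ((p - q) * (\<integral>\<eta>. quad 1 1 ?u \<eta> 0 1 \<partial>\<pi>))"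
    by simp
  then show "0 \<le> - (p - q) * (\<integral>\<eta>. cen 0 \<eta> * cen 1 \<eta> * ?u \<eta> \<partial>\<pi>)"
    unfolding integral_cen_cen[OF nu] by (simp add: mult_ac del: minus_diff_eq)
next
  show "\<bar>- (p - q)\<bar> \<le> 1" using p_nonneg q_nonneg pq by linarith
qed (auto simp: cen_upd)

section \<open>Derivative of the truncated second moment\<close>

definition speed :: real where
  "speed = (1 - 2 * \<rho>) * (p - q)"

definition second_moment :: "nat \<Rightarrow> real \<Rightarrow> real" where
  "second_moment N t = (\<Sum>x\<in>{- int N..int N}. (real_of_int x - speed * t)\<^sup>2 * cor x t)"

text \<open>\<open>4 + 2 * T\<close> collects 1 from the sum of \<open>cor\<close>, 2 from the first
  moment of \<open>cor2\<close> and \<open>2 * T + 1\<close> from the sum of \<open>cor2\<close>;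
  the last term covers two boundary values of \<open>edge\<close>.\<close>

definition slack :: "real \<Rightarrow> nat \<Rightarrow> real" where
  "slack T N = (4 + 2 * T) * tail T N + 8 * ((real N + 3 + T)\<^sup>2 * (exp (6 * T) * (1/2) ^ N))"

lemma abs_drift_le: "\<bar>p - q\<bar> \<le> 1" "\<bar>speed\<bar> \<le> 1"
proof -
  show *: "\<bar>p - q\<bar> \<le> 1" using p_nonneg q_nonneg pq by linarith
  have "\<bar>speed\<bar> \<le> 1 * 1" unfolding speed_def abs_mult using * \<rho> by (intro mult_mono) auto
  then show "\<bar>speed\<bar> \<le> 1" by simp
qed

text \<open>
  Chosen so that the derivative of \<open>second_moment\<close> is a combination of moments of \<open>cor\<close>
  and \<open>cor2\<close> plus a telescoping sum.
\<close>

definition edge :: "real \<Rightarrow> int \<Rightarrow> real" where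
  "edge t x = (real_of_int x - speed * t - 1)\<^sup>2 * flux x t
    + (p - (p - q) * \<rho>) * (1 - 2 * (real_of_int x - speed * t)) * cor (x - 1) t"

text \<open>At both ends \<open>x\<close> and \<open>x - 1\<close> are at distance at least
  \<open>N\<close> from the origin, where the exponential decay of \<open>cor\<close> and
  \<open>cor2\<close> beats the quadratic weight.\<close>

lemma edge_bound:
  assumes t: "0 \<le> t" "t \<le> T" and x: "x = int N + 1 \<or> x = - int N"
  shows "\<bar>edge t x\<bar> \<le> 4 * ((real N + 3 + T)\<^sup>2 * (exp (6 * T) * (1/2) ^ N))"
proof -
  define e where "e = exp (6 * T) * (1/2::real) ^ N"
  define X where "X = real N + 3 + T"
  have "exp (6 * T) * (1/2) ^ nat \<bar>y\<bar> \<le> e" if "int N \<le> \<bar>y\<bar>" for y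
    unfolding e_def using that by (intro mult_left_mono power_decreasing) auto
  moreover have "int N \<le> \<bar>x\<bar>" "int N \<le> \<bar>x - 1\<bar>" using x by auto
  ultimately have s: "\<bar>cor x t\<bar> \<le> e" "\<bar>cor (x - 1) t\<bar> \<le> e" "\<bar>cor2 x t\<bar> \<le> e"
    using cor_bound[OF t, of x] cor_bound[OF t, of "x - 1"] cor2_bound[OF t, of x]
    by (meson order_trans)+
  have e0: "0 \<le> e" by (simp add: e_def)
  have al: "\<bar>q + (p - q) * \<rho>\<bar> \<le> 1" and be: "\<bar>p - (p - q) * \<rho>\<bar> \<le> 1"
  proof -
    have "0 \<le> p * \<rho>" "p * \<rho> \<le> p" "0 \<le> q * \<rho>" "q * \<rho> \<le> q"
      using \<rho> p_nonneg q_nonneg by (simp_all add: mult_left_le)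
    then show "\<bar>q + (p - q) * \<rho>\<bar> \<le> 1" "\<bar>p - (p - q) * \<rho>\<bar> \<le> 1"
      using pq p_nonneg q_nonneg unfolding left_diff_distrib by linarith+
  qed
  have m: "\<bar>c * d\<bar> \<le> e" if "\<bar>c\<bar> \<le> 1" "\<bar>d\<bar> \<le> e" for c d
    using mult_mono[OF that] by (simp add: abs_mult)
  have fl: "\<bar>flux x t\<bar> \<le> 3 * e"
    using m[OF al s(1)] m[OF be s(2)] m[OF abs_drift_le(1) s(3)]
    unfolding flux_eq[OF t(1)] by linarith
  have "\<bar>speed * t\<bar> \<le> 1 * T" unfolding abs_mult using t abs_drift_le by (intro mult_mono) auto
  then have y: "\<bar>real_of_int x - speed * t - 1\<bar> \<le> X" "\<bar>1 - 2 * (real_of_int x - speed * t)\<bar> \<le> 2 * X"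
    using x t unfolding X_def by auto
  have X3: "3 \<le> X" using t by (simp add: X_def)
  have "\<bar>(real_of_int x - speed * t - 1)\<^sup>2 * flux x t\<bar> \<le> X\<^sup>2 * (3 * e)"
    unfolding abs_mult power_abs
    using y(1) fl X3 e0 by (intro mult_mono power_mono) auto
  moreover have "\<bar>(p - (p - q) * \<rho>) * (1 - 2 * (real_of_int x - speed * t)) * cor (x - 1) t\<bar> \<le> 1 * (2 * X) * e"
    unfolding abs_mult using y(2) be s(2) X3 e0 by (intro mult_mono) auto
  \<comment> \<open>\<open>3 \<le> X\<close> absorbs the linear term into the quadratic one, so 3 +
    1 gives the factor 4.\<close>
  moreover have "1 * (2 * X) * e \<le> X\<^sup>2 * e"
    unfolding power2_eq_square using X3 e0 by (intro mult_right_mono) auto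
  ultimately have "\<bar>edge t x\<bar> \<le> X\<^sup>2 * (3 * e) + X\<^sup>2 * e"
    unfolding edge_def by linarith
  then show ?thesis by (simp add: X_def e_def algebra_simps)
qed

lemma second_moment_derivative:
  assumes t: "0 < t" "t \<le> T" and N: "0 < N"
  obtains d where "(second_moment N has_real_derivative d) (at t)" "- slack T N \<le> d"
proof -
  let ?J = "{- int N..int N}"
  let ?y = "\<lambda>x. real_of_int x - speed * t"
  let ?d = "\<lambda>x. - 2 * speed * ?y x * cor x t + (?y x)\<^sup>2 * (flux (x + 1) t - flux x t)"
  have t0: "0 \<le> t" using t by simp
  have deriv: "(second_moment N has_real_derivative (\<Sum>x\<in>?J. ?d x)) (at t)"
    unfolding second_moment_def
    by (rule DERIV_sum) (auto intro!: derivative_eq_intros cor_derivative t simp: algebra_simps)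
  have summand: "?d x = cor x t - 2 * (p - q) * (real_of_int x * cor2 x t)
      + (p - q) * (2 * speed * t + 1) * cor2 x t + (edge t (x + 1) - edge t x)" for x
  proof -
    define B where "B = p - (p - q) * \<rho>"
    \<comment> \<open>In terms of \<open>B\<close> the coefficients of \<open>flux\<close> and the
      speed are all affine, which reduces the claim to a polynomial identity.\<close>
    have A: "q + (p - q) * \<rho> = 1 - B" and v: "speed = 2 * B - 1"
      using pq by (simp_all add: B_def speed_def algebra_simps)
    have fl: "flux x t = (1 - B) * cor x t - B * cor (x - 1) t + (p - q) * cor2 x t"
      using flux_eq[OF t0, of x] by (simp only: A B_def)
    have e0: "edge t x = (?y x - 1)\<^sup>2 * flux x t + B * (1 - 2 * ?y x) * cor (x - 1) t"
      by (simp add: edge_def B_def)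
    have e1: "edge t (x + 1) = (?y x)\<^sup>2 * flux (x + 1) t + B * (- 1 - 2 * ?y x) * cor x t"
      by (simp add: edge_def B_def algebra_simps)
    \<comment> \<open>The relation \<open>v = 2 * B - 1\<close> is what cancels the terms in
      \<open>y * s\<close>; \<open>s\<close> itself survives, and its sum over the sites plays the
      part of chi.\<close>
    have identity: "- 2 * v * y * s + y\<^sup>2 * (f1 - f0) = s - 2 * d * ((y + v * t) * r)
        + d * (2 * v * t + 1) * r
        + ((y\<^sup>2 * f1 + B * (- 1 - 2 * y) * s) - ((y - 1)\<^sup>2 * f0 + B * (1 - 2 * y) * s'))"
      if "v = 2 * B - 1" "f0 = (1 - B) * s - B * s' + d * r" for v y s s' r d f0 f1 :: real
      unfolding that by (simp add: algebra_simps power2_eq_square)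
    show ?thesis
      using identity[OF v fl, of "?y x" "flux (x + 1) t"] unfolding e0 e1 by simp
  qed
  have "(\<Sum>x\<in>?J. ?d x) = (\<Sum>x\<in>?J. cor x t) + 2 * (- (p - q) * (\<Sum>x\<in>?J. real_of_int x * cor2 x t))
     + (p - q) * (2 * speed * t + 1) * (\<Sum>x\<in>?J. cor2 x t) + (edge t (int N + 1) - edge t (- int N))"
  proof -
    have "{- int N..int N} = {- int N..<- int N + int (2 * N + 1)}" by auto
    then have "(\<Sum>x\<in>?J. edge t (x + 1) - edge t x) = edge t (int N + 1) - edge t (- int N)"
      using sum_telescope_int[of "edge t" "- int N" "2 * N + 1"] by simp
    then show ?thesis
      unfolding summand sum.distrib sum_subtractf sum_distrib_left[symmetric] by (simp add: algebra_simps)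
  qed
  moreover have "\<bar>(p - q) * (2 * speed * t + 1) * (\<Sum>x\<in>?J. cor2 x t)\<bar> \<le> (2 * T + 1) * tail T N"
  proof -
    have "\<bar>speed * t\<bar> \<le> 1 * T" unfolding abs_mult using t abs_drift_le by (intro mult_mono) auto
    then have "\<bar>2 * speed * t + 1\<bar> \<le> 2 * T + 1" by linarith
    then have "\<bar>(p - q) * (2 * speed * t + 1) * (\<Sum>x\<in>?J. cor2 x t)\<bar> \<le> 1 * (2 * T + 1) * tail T N"
      unfolding abs_mult using t abs_drift_le(1) sum_cor2_bound[OF t0 t(2) N] by (intro mult_mono) auto
    then show ?thesis by simp
  qed
  moreover have "- tail T N \<le> (\<Sum>x\<in>?J. cor x t)"
    "- tail T N \<le> - (p - q) * (\<Sum>x\<in>?J. real_of_int x * cor2 x t)"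
    using sum_cor_lower[OF t0 t(2) N] sum_first_moment_cor2[OF t0 t(2) N] by auto
  moreover have "\<bar>edge t (int N + 1)\<bar> \<le> 4 * ((real N + 3 + T)\<^sup>2 * (exp (6 * T) * (1/2) ^ N))"
    "\<bar>edge t (- int N)\<bar> \<le> 4 * ((real N + 3 + T)\<^sup>2 * (exp (6 * T) * (1/2) ^ N))"
    using edge_bound[OF t0 t(2)] by auto
  moreover have "slack T N = tail T N + 2 * tail T N + (2 * T + 1) * tail T N
      + (4 * ((real N + 3 + T)\<^sup>2 * (exp (6 * T) * (1/2) ^ N)) + 4 * ((real N + 3 + T)\<^sup>2 * (exp (6 * T) * (1/2) ^ N)))"
    unfolding slack_def by (simp add: algebra_simps)
  ultimately have "- slack T N \<le> (\<Sum>x\<in>?J. ?d x)" by linarith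
  with deriv show thesis by (rule that)
qed

text \<open>\<open>slack t N\<close> bounds the derivative from below uniformly up to time
  \<open>t\<close>, so adding a linear function with this slope restores monotonicity.\<close>

lemma second_moment_increment:
  assumes "0 < s" "s \<le> t" "0 < N"
  shows "second_moment N s + slack t N * s \<le> second_moment N t + slack t N * t"
proof (rule DERIV_nonneg_imp_nondecreasing[OF assms(2)])
  fix u assume u: "s \<le> u" "u \<le> t"
  then have "0 < u" using assms(1) by simp
  then obtain d where "(second_moment N has_real_derivative d) (at u)" "- slack t N \<le> d"
    using second_moment_derivative[OF _ u(2) assms(3)] by blast
  then show "\<exists>y. ((\<lambda>u. second_moment N u + slack t N * u) has_real_derivative y) (at u) \<and> 0 \<le> y"
    by (intro exI[of _ "d + slack t N"]) (auto intro!: derivative_eq_intros)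
qed

section \<open>Removal of the truncation\<close>

lemma slack_tendsto: "(\<lambda>N. slack T N) \<longlonglongrightarrow> 0"
proof -
  have "(\<lambda>N. (4 * real N + 1) * (2 * real N) * (1/2) ^ N) \<longlonglongrightarrow> 0" by real_asymp
  then have "(\<lambda>N. (4 + 2 * T) * ((2 * T + 1) * exp (6 * T)) * ((4 * real N + 1) * (2 * real N) * (1/2) ^ N)) \<longlonglongrightarrow> 0"
    by (rule tendsto_mult_right_zero)
  moreover have "(\<lambda>N. (real N + 3 + T)\<^sup>2 * (1/2) ^ N) \<longlonglongrightarrow> 0" by real_asymp
  then have "(\<lambda>N. 8 * exp (6 * T) * ((real N + 3 + T)\<^sup>2 * (1/2) ^ N)) \<longlonglongrightarrow> 0"
    by (rule tendsto_mult_right_zero)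
  ultimately have "(\<lambda>N. (4 + 2 * T) * ((2 * T + 1) * exp (6 * T)) * ((4 * real N + 1) * (2 * real N) * (1/2) ^ N)
      + 8 * exp (6 * T) * ((real N + 3 + T)\<^sup>2 * (1/2) ^ N)) \<longlonglongrightarrow> 0"
    by (rule tendsto_add_zero)
  then show ?thesis unfolding slack_def tail_def by (simp add: mult_ac)
qed

text \<open>\<open>infsum\<close> is a limit along all finite sets of sites; this restricts it to a
  sequence of intervals.\<close>

lemma symmetric_intervals_exhaust:
  "filterlim (\<lambda>N. {- int N..int N}) (finite_subsets_at_top UNIV) sequentially"
  unfolding filterlim_finite_subsets_at_top
proof safe
  fix X :: "int set" assume X: "finite X"
  define m where "m = nat (Max (insert 0 (abs ` X)))"
  have "X \<subseteq> {- int N..int N}" if "m \<le> N" for N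
  proof
    fix x assume "x \<in> X"
    then have "\<bar>x\<bar> \<le> Max (insert 0 (abs ` X))" using X by (intro Max_ge) auto
    then show "x \<in> {- int N..int N}" using that unfolding m_def by auto
  qed
  then show "\<forall>\<^sub>F N in sequentially. finite {- int N..int N} \<and> X \<subseteq> {- int N..int N} \<and> {- int N..int N} \<subseteq> UNIV"
    unfolding eventually_sequentially by blast
qed

lemma summable_on_int_exp:
  "(\<lambda>x::int. (real_of_int \<bar>x\<bar> + T)\<^sup>2 * (C * (1/2) ^ nat \<bar>x\<bar>)) summable_on UNIV"
proof -
  let ?f = "\<lambda>x::int. (real_of_int \<bar>x\<bar> + T)\<^sup>2 * (C * (1/2) ^ nat \<bar>x\<bar>)"
  let ?h = "\<lambda>n::nat. C * ((real n + T)\<^sup>2 * (1/2) ^ n)"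
  \<comment> \<open>A ratio strictly between 1/2 and 1 absorbs the quadratic factor.\<close>
  have "(\<lambda>n::nat. (real n + T)\<^sup>2 * (1/2) ^ n) \<in> O(\<lambda>n. (3/4) ^ n)" by real_asymp
  moreover have "summable (\<lambda>n. norm ((3/4 :: real) ^ n))"
    by (simp add: summable_geometric)
  ultimately have "summable (\<lambda>n::nat. (real n + T)\<^sup>2 * (1/2) ^ n)"
    by (rule summable_comparison_test_bigo[rotated])
  then have "summable (\<lambda>n::nat. norm ((real n + T)\<^sup>2 * (1/2) ^ n))"
    by (simp add: abs_mult)
  then have "(\<lambda>n::nat. (real n + T)\<^sup>2 * (1/2) ^ n) summable_on UNIV"
    by (rule norm_summable_imp_summable_on)
  then have h: "?h summable_on UNIV" by (rule summable_on_cmult_right)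
  have 1: "?f summable_on range int"
    by (subst summable_on_reindex) (use h in \<open>auto simp: o_def mult_ac\<close>)
  have 2: "?f summable_on range (\<lambda>n. - int n)"
    by (subst summable_on_reindex) (use h in \<open>auto simp: o_def mult_ac inj_on_def\<close>)
  have "range int \<union> range (\<lambda>n. - int n) = UNIV"
  proof -
    have "x \<in> range int \<union> range (\<lambda>n. - int n)" for x :: int
      by (cases x rule: int_cases2) auto
    then show ?thesis by blast
  qed
  then show ?thesis using summable_on_union[OF 1 2] by simp
qed

lemma second_moment_tendsto:
  assumes t: "0 \<le> t"
  shows "(\<lambda>N. second_moment N t) \<longlonglongrightarrow> (\<Sum>\<^sub>\<infinity>x. (real_of_int x - speed * t)\<^sup>2 * cor x t)"
proof -
  let ?f = "\<lambda>x. (real_of_int x - speed * t)\<^sup>2 * cor x t"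
  have "?f summable_on UNIV"
  proof (rule Infinite_Sum.abs_summable_summable, rule Infinite_Sum.abs_summable_on_comparison_test'[OF summable_on_int_exp])
    fix x :: int
    have "\<bar>speed * t\<bar> \<le> 1 * t" unfolding abs_mult using t abs_drift_le by (intro mult_mono) auto
    then have "\<bar>real_of_int x - speed * t\<bar> \<le> real_of_int \<bar>x\<bar> + t" by simp
    then have "\<bar>real_of_int x - speed * t\<bar>\<^sup>2 \<le> (real_of_int \<bar>x\<bar> + t)\<^sup>2" by (intro power_mono) auto
    then show "norm (?f x) \<le> (real_of_int \<bar>x\<bar> + t)\<^sup>2 * (exp (6 * t) * (1/2) ^ nat \<bar>x\<bar>)"
      unfolding real_norm_def abs_mult power_abs
      using cor_bound[OF t order_refl, of x] by (intro mult_mono) auto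
  qed
  then have "(sum ?f \<longlongrightarrow> infsum ?f UNIV) (finite_subsets_at_top UNIV)"
    using has_sum_infsum unfolding has_sum_def by blast
  from filterlim_compose[OF this symmetric_intervals_exhaust]
  show ?thesis by (simp add: second_moment_def)
qed

lemma infsum_second_moment_mono:
  assumes "0 < s" "s \<le> t"
  shows "(\<Sum>\<^sub>\<infinity>x. (real_of_int x - speed * s)\<^sup>2 * cor x s) \<le> (\<Sum>\<^sub>\<infinity>x. (real_of_int x - speed * t)\<^sup>2 * cor x t)"
proof -
  have lim: "(\<lambda>N. second_moment N u + slack t N * u)
      \<longlonglongrightarrow> (\<Sum>\<^sub>\<infinity>x. (real_of_int x - speed * u)\<^sup>2 * cor x u) + 0 * u" if "0 \<le> u" for u
    by (intro tendsto_intros second_moment_tendsto slack_tendsto that)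
  have "\<exists>N. \<forall>n\<ge>N. second_moment n s + slack t n * s \<le> second_moment n t + slack t n * t"
    using second_moment_increment[OF assms] by (intro exI[of _ 1]) auto
  with LIMSEQ_le[OF lim[of s] lim[of t]] assms show ?thesis by simp
qed

end

section \<open>The process\<close>

text \<open>\<open>cen 0\<close> of the initial configuration is measurable for the history at time
  0, so \<open>occ x\<close> at time \<open>t\<close> may be replaced by its conditional
  expectation. The centring of \<open>occ x\<close> drops out because \<open>cen 0\<close> has mean
  zero.\<close>

lemma (in bernoulli) two_point_eq:
  fixes F :: observable
  assumes M: "prob_space M" and \<eta>: "\<And>t. 0 \<le> t \<Longrightarrow> \<eta> t \<in> M \<rightarrow>\<^sub>M borel"
    and law: "distr M borel (\<eta> 0) = bernoulli_product \<rho>" and t: "0 \<le> t"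
    and markov: "AE \<omega> in M. real_cond_exp M (history M \<eta> 0) (\<lambda>\<omega>. obs (occ x) (\<eta> (0 + t) \<omega>)) \<omega>
      = F (\<eta> 0 \<omega>)"
  shows "two_point \<rho> M \<eta> x t = pairing (cen 0) F"
proof -
  interpret M: prob_space M by fact
  let ?H = "history M \<eta> 0"
  let ?A = "{\<eta> u -` B \<inter> space M | u B. 0 \<le> u \<and> u \<le> 0 \<and> B \<in> sets borel}"
  have A: "?A \<subseteq> Pow (space M)" by auto
  have space_H: "space ?H = space M"
    unfolding history_def using A by (rule space_measure_of)
  have sets_H: "sets ?H = sigma_sets (space M) ?A"
    unfolding history_def using A by (rule sets_measure_of)
  have "subalgebra M ?H"
    unfolding subalgebra_def space_H sets_H
    using measurable_sets[OF \<eta>] by (auto intro!: sets.sigma_sets_subset)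
  then interpret finite_measure_subalgebra M ?H
    by unfold_locales
  have \<eta>H: "\<eta> 0 \<in> ?H \<rightarrow>\<^sub>M borel"
    unfolding measurable_def space_H sets_H by (auto intro!: sigma_sets.Basic)
  have b: "g \<in> borel_measurable borel" if "nice g" for g using that by (simp add: nice_def)
  have fm: "(\<lambda>\<omega>. g (\<eta> u \<omega>)) \<in> borel_measurable M" if "nice g" "0 \<le> u" for g u
    using measurable_compose[OF \<eta>[OF that(2)] b[OF that(1)]] .
  let ?c = "\<lambda>\<omega>. cen 0 (\<eta> 0 \<omega>)" and ?o = "\<lambda>\<omega>. occ x (\<eta> t \<omega>)"
  have cH: "?c \<in> borel_measurable ?H"
    using measurable_compose[OF \<eta>H b[OF nice_cen]] .
  have cM: "?c \<in> borel_measurable M" and oM: "?o \<in> borel_measurable M"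
    using t by (auto intro!: fm nice_cen nice_occ)
  have o1: "\<bar>?o \<omega>\<bar> \<le> 1" for \<omega> by (simp add: occ_def)
  have int_c: "integrable M ?c"
    using cM cen_bound by (intro M.integrable_const_bound[of _ 1]) auto
  have int: "integrable M (\<lambda>\<omega>. ?c \<omega> * ?o \<omega>)"
    using cM oM mult_mono[OF cen_bound o1]
    by (intro M.integrable_const_bound[of _ 1]) (auto simp: abs_mult)
  have transfer: "(\<integral>\<omega>. g (\<eta> 0 \<omega>) \<partial>M) = (\<integral>\<eta>. g \<eta> \<partial>\<pi>)" if "nice g" for g
    using integral_distr[OF \<eta>[of 0] b[OF that]] law by (simp add: \<pi>_def)
  have "(\<integral>\<omega>. ?c \<omega> * ?o \<omega> \<partial>M) = (\<integral>\<omega>. ?c \<omega> * real_cond_exp M ?H ?o \<omega> \<partial>M)"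
    using real_cond_exp_intg(2)[OF int cH oM] by simp
  also have "\<dots> = (\<integral>\<omega>. ?c \<omega> * F (\<eta> 0 \<omega>) \<partial>M)"
    using markov cM fm[OF nice_bcontfun, of 0 F]
    by (intro integral_cong_AE borel_measurable_times) auto
  also have "\<dots> = pairing (cen 0) F"
    unfolding pairing_def
    using transfer[OF nice_mult[OF nice_cen nice_bcontfun], of 0 F] .
  finally have main: "(\<integral>\<omega>. ?c \<omega> * ?o \<omega> \<partial>M) = pairing (cen 0) F" .
  have zero: "(\<integral>\<omega>. ?c \<omega> \<partial>M) = 0"
    using transfer[OF nice_cen, of 0] integral_cen_mult[OF nice_const[of 1], of 0] by simp
  have "two_point \<rho> M \<eta> x t = (\<integral>\<omega>. ?c \<omega> * ?o \<omega> - \<rho> * ?c \<omega> \<partial>M)"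
    unfolding two_point_def
    by (intro Bochner_Integration.integral_cong refl) (simp add: cen_def occ_def algebra_simps)
  also have "\<dots> = pairing (cen 0) F"
    using int int_c by (simp add: main zero)
  finally show ?thesis .
qed

lemma drift_nearest_neighbor:
  assumes "nearest_neighbor p"
  shows "drift p = pmf p 1 - pmf p (- 1)"
proof -
  have "drift p = (\<Sum>\<^sub>\<infinity>z\<in>{1, - 1}. real_of_int z * pmf p z)"
    unfolding drift_def using assms
    by (intro infsum_cong_neutral) (auto simp: nearest_neighbor_def)
  then show ?thesis by simp
qed

theorem proposition4:
  fixes p :: "int pmf" and \<rho> :: real
    and M :: "'w measure" and \<eta> :: "real \<Rightarrow> 'w \<Rightarrow> config"
  assumes "0 < \<rho>" "\<rho> < 1"
    and "nearest_neighbor p"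
    and "drift p \<noteq> 0"
    and "stationary_exclusion_process p \<rho> M \<eta>"
  shows "mono_on {0<..} (\<lambda>t. t * diffusivity p \<rho> M \<eta> t)"
proof -
  from assms(5) obtain P where M: "prob_space M" and \<eta>: "\<And>t. 0 \<le> t \<Longrightarrow> \<eta> t \<in> M \<rightarrow>\<^sub>M borel"
    and P: "exclusion_semigroup p P"
    and cond: "\<And>s t f. 0 \<le> s \<Longrightarrow> 0 \<le> t \<Longrightarrow> AE \<omega> in M.
           real_cond_exp M (history M \<eta> s) (\<lambda>\<omega>. apply_bcontfun f (\<eta> (s + t) \<omega>)) \<omega>
           = apply_bcontfun (P t f) (\<eta> s \<omega>)"
    and law: "distr M borel (\<eta> 0) = bernoulli_product \<rho>"
    unfolding stationary_exclusion_process_def exclusion_process_def by blast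
  interpret stationary_semigroup p P \<rho>
    using assms P by unfold_locales auto
  have two: "two_point \<rho> M \<eta> x t = cor x t" if "0 \<le> t" for x t
    unfolding cor_def by (rule two_point_eq[OF M \<eta> law that cond]) (use that in auto)
  have v: "(1 - 2 * \<rho>) * drift p = speed"
    using drift_nearest_neighbor[OF assms(3)] by (simp add: speed_def)
  \<comment> \<open>The factor \<open>t\<close> cancels the inverse time and leaves the second
    moment divided by chi.\<close>
  have tD: "t * diffusivity p \<rho> M \<eta> t
      = inverse (\<rho> * (1 - \<rho>)) * (\<Sum>\<^sub>\<infinity>x. (real_of_int x - speed * t)\<^sup>2 * cor x t)" if "0 < t" for t
    unfolding diffusivity_def v using that two by simp
  show ?thesis
  proof (rule mono_onI)
    fix s t :: real assume "s \<in> {0<..}" "t \<in> {0<..}" "s \<le> t"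
    then show "s * diffusivity p \<rho> M \<eta> s \<le> t * diffusivity p \<rho> M \<eta> t"
      using infsum_second_moment_mono[of s t] assms(1,2) by (simp add: tD mult_left_mono)
  qed
qed

end
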